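(* Let $\{G_i\mid i\in I\}$ be a family of Gödel algebras and $Y_i=(G_i)_*$ their dual Esakia spaces. Then the coproduct of $\{G_i\mid i\in I\}$ in the category of Gödel algebras (with Heyting homomorphisms) is $(\bigotimes_i Y_i)^*$ together with, for each $i\in I$, the map sending $a\in G_i$ to $\Box\,\pi_i^{-1}[\sigma_{G_i}(a)]\cap\bigotimes_iY_i=\{C\in\bigotimes_i Y_i\mid C\subseteq\pi_i^{-1}[\sigma_{G_i}(a)]\}$.
   Context: For a distributive lattice $L$, $L_*$ is its set of prime filters ordered by inclusion with topology generated by $\sigma_L(a)=\{P\mid a\in P\}$ and their complements; for a Gödel algebra (Heyting algebra with $(x\to y)\vee(y\to x)=1$) this is an Esakia space which is a root system (${\uparrow}y$ is a chain for all $y$). $\prod_i Y_i$ is the cartesian product with product topology and componentwise order, $\pi_i$ the projections. For a Priestley space $X$, $\mathsf{CC}(X)$ is the set of nonempty closed chains of $X$, with topology generated by $\Box V=\{C\mid C\subseteq V\}$, $\Diamond V=\{C\mid C\cap V\neq\varnothing\}$ ($V$ clopen) and order $C_1\unlhd C_2$ iff $C_2\subseteq C_1$ and $C_2$ is an upset of $C_1$. Define $\bigotimes_{i\in I}Y_i=\{C\in\mathsf{CC}(\prod_iY_i)\mid \pi_i[C]\text{ is an upset of }Y_i\text{ for all }i\in I\}$ with the induced topology and order. For an Esakia space $Y$, $Y^*$ denotes the Heyting algebra of clopen upsets with $U\to V=Y\setminus{\downarrow}(U\setminus V)$. *)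

theory Defs
  imports "HOL-Algebra.Lattice" "HOL-Analysis.Analysis"
begin

section \<open>Heyting and Goedel algebras\<close>

record 'a heyting = "'a gorder" +
  imp :: "'a \<Rightarrow> 'a \<Rightarrow> 'a" (infixr \<open>\<Rrightarrow>\<index>\<close> 60)

locale heyting_algebra = bounded_lattice L
  for L :: "('a, 'm) heyting_scheme" (structure) +
  assumes imp_closed:
      "\<lbrakk>x \<in> carrier L; y \<in> carrier L\<rbrakk> \<Longrightarrow> x \<Rrightarrow> y \<in> carrier L"
    and residuation:
      "\<lbrakk>x \<in> carrier L; y \<in> carrier L; z \<in> carrier L\<rbrakk>
        \<Longrightarrow> z \<sqsubseteq> x \<Rrightarrow> y \<longleftrightarrow> z \<sqinter> x \<sqsubseteq> y"

locale godel_algebra = heyting_algebra +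
  assumes prelinearity:
      "\<lbrakk>x \<in> carrier L; y \<in> carrier L\<rbrakk> \<Longrightarrow> (x \<Rrightarrow> y) \<squnion> (y \<Rrightarrow> x) = \<top>"

definition heyting_hom ::
  "('a, 'm) heyting_scheme \<Rightarrow> ('b, 'n) heyting_scheme \<Rightarrow> ('a \<Rightarrow> 'b) set" where
  "heyting_hom L M = {h \<in> carrier L \<rightarrow> carrier M.
     h \<bottom>\<^bsub>L\<^esub> = \<bottom>\<^bsub>M\<^esub> \<and> h \<top>\<^bsub>L\<^esub> = \<top>\<^bsub>M\<^esub> \<and>
     (\<forall>x\<in>carrier L. \<forall>y\<in>carrier L.
        h (x \<sqinter>\<^bsub>L\<^esub> y) = h x \<sqinter>\<^bsub>M\<^esub> h y \<and>
        h (x \<squnion>\<^bsub>L\<^esub> y) = h x \<squnion>\<^bsub>M\<^esub> h y \<and>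
        h (x \<Rrightarrow>\<^bsub>L\<^esub> y) = h x \<Rrightarrow>\<^bsub>M\<^esub> h y)}"

text \<open>
  The test objects of the universal property have carriers in an arbitrary type \<open>'c\<close>.  HOL
  cannot quantify over types inside a formula, so \<open>'c\<close> is passed as an argument; a theorem
  about \<open>TYPE('c)\<close> with \<open>'c\<close> a type variable holds for all types.
  Only the values of a homomorphism on the carrier matter, so uniqueness of the mediating
  homomorphism is stated among functions that are \<^const>\<open>undefined\<close> outside of the carrier.
\<close>

definition godel_coproduct ::
  "'c itself \<Rightarrow> 'i set \<Rightarrow> ('i \<Rightarrow> 'a heyting) \<Rightarrow> 'b heyting \<Rightarrow> ('i \<Rightarrow> 'a \<Rightarrow> 'b) \<Rightarrow> bool" where
  "godel_coproduct _ I G K e \<longleftrightarrow>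
     godel_algebra K \<and>
     (\<forall>i\<in>I. e i \<in> heyting_hom (G i) K) \<and>
     (\<forall>(H :: 'c heyting) f.
        godel_algebra H \<and> (\<forall>i\<in>I. f i \<in> heyting_hom (G i) H) \<longrightarrow>
        (\<exists>!h. h \<in> heyting_hom K H \<and> h \<in> extensional (carrier K) \<and>
              (\<forall>i\<in>I. \<forall>a\<in>carrier (G i). h (e i a) = f i a)))"


section \<open>Ordered topological spaces\<close>

text \<open>The underlying set is the \<^const>\<open>topspace\<close> of the topology.\<close>

record 'a ospace =
  otop :: "'a topology"
  ole :: "'a \<Rightarrow> 'a \<Rightarrow> bool"

abbreviation points :: "('a, 'm) ospace_scheme \<Rightarrow> 'a set" where
  "points X \<equiv> topspace (otop X)"

definition is_upset :: "('a \<Rightarrow> 'a \<Rightarrow> bool) \<Rightarrow> 'a set \<Rightarrow> 'a set \<Rightarrow> bool" where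
  "is_upset r A U \<longleftrightarrow> U \<subseteq> A \<and> (\<forall>x\<in>U. \<forall>y\<in>A. r x y \<longrightarrow> y \<in> U)"

definition downset :: "'a ospace \<Rightarrow> 'a set \<Rightarrow> 'a set" where
  "downset X A = {x \<in> points X. \<exists>y\<in>A. ole X x y}"

definition clopens :: "'a ospace \<Rightarrow> 'a set set" where
  "clopens X = {U. openin (otop X) U \<and> closedin (otop X) U}"

definition upset_algebra :: "'a ospace \<Rightarrow> 'a set heyting" where
  "upset_algebra Y =
     \<lparr>carrier = {U \<in> clopens Y. is_upset (ole Y) (points Y) U},
      eq = (=), le = (\<subseteq>),
      imp = (\<lambda>U V. points Y - downset Y (U - V))\<rparr>"

definition prod_ospace :: "'i set \<Rightarrow> ('i \<Rightarrow> 'a ospace) \<Rightarrow> ('i \<Rightarrow> 'a) ospace" where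
  "prod_ospace I Y =
     \<lparr>otop = product_topology (\<lambda>i. otop (Y i)) I,
      ole = (\<lambda>x y. \<forall>i\<in>I. ole (Y i) (x i) (y i))\<rparr>"


section \<open>The dual space of an algebra\<close>

definition prime_filters :: "('a, 'm) gorder_scheme \<Rightarrow> 'a set set" where
  "prime_filters L = {P. is_upset (le L) (carrier L) P \<and> P \<noteq> {} \<and> P \<noteq> carrier L \<and>
     (\<forall>x\<in>P. \<forall>y\<in>P. x \<sqinter>\<^bsub>L\<^esub> y \<in> P) \<and>
     (\<forall>x\<in>carrier L. \<forall>y\<in>carrier L. x \<squnion>\<^bsub>L\<^esub> y \<in> P \<longrightarrow> x \<in> P \<or> y \<in> P)}"

definition stone_map :: "('a, 'm) gorder_scheme \<Rightarrow> 'a \<Rightarrow> 'a set set" where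
  "stone_map L a = {P \<in> prime_filters L. a \<in> P}"

definition dual_space :: "('a, 'm) gorder_scheme \<Rightarrow> 'a set ospace" where
  "dual_space L =
     \<lparr>otop = topology_generated_by
        (stone_map L ` carrier L \<union> (\<lambda>a. prime_filters L - stone_map L a) ` carrier L),
      ole = (\<subseteq>)\<rparr>"


section \<open>Closed chains and the tensor product of spaces\<close>

definition closed_chains :: "'a ospace \<Rightarrow> 'a set set" where
  "closed_chains X =
     {C. C \<noteq> {} \<and> closedin (otop X) C \<and> Complete_Partial_Order.chain (ole X) C}"

definition Box :: "'a ospace \<Rightarrow> 'a set \<Rightarrow> 'a set set" where
  "Box X V = {C \<in> closed_chains X. C \<subseteq> V}"

definition Diamond :: "'a ospace \<Rightarrow> 'a set \<Rightarrow> 'a set set" where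
  "Diamond X V = {C \<in> closed_chains X. C \<inter> V \<noteq> {}}"

definition CC :: "'a ospace \<Rightarrow> 'a set ospace" where
  "CC X =
     \<lparr>otop = topology_generated_by (Box X ` clopens X \<union> Diamond X ` clopens X),
      ole = (\<lambda>C1 C2. is_upset (ole X) C1 C2)\<rparr>"

definition tensor :: "'i set \<Rightarrow> ('i \<Rightarrow> 'a ospace) \<Rightarrow> ('i \<Rightarrow> 'a) set ospace" where
  "tensor I Y =
     \<lparr>otop = subtopology (otop (CC (prod_ospace I Y)))
        {C \<in> closed_chains (prod_ospace I Y).
           \<forall>i\<in>I. is_upset (ole (Y i)) (points (Y i)) ((\<lambda>x. x i) ` C)},
      ole = ole (CC (prod_ospace I Y))\<rparr>"

definition coprod_map ::
  "'i set \<Rightarrow> ('i \<Rightarrow> 'a heyting) \<Rightarrow> 'i \<Rightarrow> 'a \<Rightarrow> ('i \<Rightarrow> 'a set) set set" where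
  "coprod_map I G i a =
     (let Y = (\<lambda>j. dual_space (G j)); X = prod_ospace I Y
      in Box X {x \<in> points X. x i \<in> stone_map (G i) a} \<inter> points (tensor I Y))"


section \<open>Sanity checks for the encodings\<close>

lemma clopens_points: "points X \<in> clopens X"
  by (simp add: clopens_def)

lemma points_CC: "points (CC X) = closed_chains X"
proof -
  have "Box X (points X) = closed_chains X"
    by (auto simp: Box_def closed_chains_def dest: closedin_subset)
  then have "closed_chains X \<in> Box X ` clopens X"
    using clopens_points by (metis imageI)
  then show ?thesis
    by (auto simp: CC_def topology_generated_by_topspace Box_def Diamond_def)
qed

lemma points_tensor:
  "points (tensor I Y) = {C \<in> closed_chains (prod_ospace I Y).
     \<forall>i\<in>I. is_upset (ole (Y i)) (points (Y i)) ((\<lambda>x. x i) ` C)}"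
  using points_CC[of "prod_ospace I Y"] by (auto simp: tensor_def)

lemma points_dual_space:
  assumes "carrier L \<noteq> {}"
  shows "points (dual_space L) = prime_filters L"
  using assms by (auto simp: dual_space_def topology_generated_by_topspace stone_map_def)

lemma coprod_map_eq:
  "coprod_map I G i a = {C \<in> points (tensor I (\<lambda>j. dual_space (G j))).
     C \<subseteq> {x \<in> points (prod_ospace I (\<lambda>j. dual_space (G j))). x i \<in> stone_map (G i) a}}"
  by (auto simp: coprod_map_def Let_def Box_def points_tensor)

end

theory Submission
  imports Defs
begin

text \<open>
  The points of the tensor product form an upset of the space of closed chains of the product, which
  makes the tensor product an Esakia root system: upsets of a chain are comparable, and downsets of
  clopens can be computed because along a chain finitely many witnesses have a least one.  A chain is
  separated from one not above it by \<open>\<box>V \<rightarrow> \<box>W\<close> or \<open>(\<box>V \<rightarrow> \<box>W) \<rightarrow> \<box>A\<close>, so by compactness the clopen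
  upsets are generated, as a Heyting algebra, by the images of the \<open>G\<^sub>i\<close>.  This gives uniqueness of
  the mediating homomorphism.  For existence, a prime filter \<open>P\<close> of \<open>H\<close> is sent to the closed
  chain of all \<open>(f\<^sub>i\<^sup>-\<^sup>1[Q])\<^sub>i\<close> with \<open>Q \<supseteq> P\<close>; this map is a p-morphism, so the clopen upsets whose
  preimage is represented by an element of \<open>H\<close> form a Heyting subalgebra containing the generators.
\<close>

text \<open>Three obstacles shape the proof. The topology on closed chains is hard to handle
  directly, so compactness is read off a Cantor cube: a closed set is coded by the clopens that
  contain it, and both defining conditions of the tensor product become conditions on finitely many
  coordinates at a time. For the projections this rests on the implication of \<open>G i\<close>: a
  chain with upset projections that avoids \<open>cyl i a - cyl i b\<close> must lie in
  \<open>cyl i (a \<Rrightarrow> b)\<close>, and conversely these instances force the projection to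
  be an upset. Next, the implication of two clopen upsets exists only if downsets of clopens are
  clopen; for a box intersected with one diamond the downset has an explicit description, in which
  the extremal points of closed chains decide openness and closedness. Finally, existence works with
  elements of \<open>H\<close> themselves: a clopen upset is matched with an element of
  \<open>H\<close> by testing prime filters, so that each Heyting operation reduces to a property of
  prime filters.\<close>

section \<open>Clopen upsets and Priestley spaces\<close>

text \<open>Closure under binary unions lets a single member of the cover replace the finite
  subcover. The empty set is demanded because that subcover may be empty.\<close>

lemma compactin_directed:
  assumes "compactin X D"
    and op: "\<And>U. U \<in> \<U> \<Longrightarrow> openin X U"
    and "{} \<in> \<U>"
    and Un: "\<And>U V. U \<in> \<U> \<Longrightarrow> V \<in> \<U> \<Longrightarrow> U \<union> V \<in> \<U>"
    and "D \<subseteq> \<Union>\<U>"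
  obtains U where "U \<in> \<U>" "D \<subseteq> U"
proof -
  obtain \<F> where \<F>: "finite \<F>" "\<F> \<subseteq> \<U>" "D \<subseteq> \<Union>\<F>"
    using assms(1,5) op unfolding compactin_def by metis
  have "\<Union>\<F> \<in> \<U>"
    using \<F>(1,2) by induction (auto intro: Un \<open>{} \<in> \<U>\<close>)
  with \<F>(3) that show ?thesis by blast
qed

definition clopen_upsets :: "'a ospace \<Rightarrow> 'a set set" where
  "clopen_upsets X = {U \<in> clopens X. is_upset (ole X) (points X) U}"

lemma clopens_subset: "U \<in> clopens X \<Longrightarrow> U \<subseteq> points X"
  by (auto simp: clopens_def dest: openin_subset)

lemma empty_clopens: "{} \<in> clopens X"
  by (simp add: clopens_def)

lemma clopens_Un: "U \<in> clopens X \<Longrightarrow> V \<in> clopens X \<Longrightarrow> U \<union> V \<in> clopens X"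
  by (auto simp: clopens_def)

lemma clopens_Int: "U \<in> clopens X \<Longrightarrow> V \<in> clopens X \<Longrightarrow> U \<inter> V \<in> clopens X"
  by (auto simp: clopens_def)

lemma clopens_Diff: "U \<in> clopens X \<Longrightarrow> V \<in> clopens X \<Longrightarrow> U - V \<in> clopens X"
  by (auto simp: clopens_def openin_diff closedin_diff)

lemmas clopens_intros = clopens_points empty_clopens clopens_Un clopens_Int clopens_Diff

lemma clopen_upsets_clopens: "U \<in> clopen_upsets X \<Longrightarrow> U \<in> clopens X"
  by (simp add: clopen_upsets_def)

lemma clopen_upsets_subset: "U \<in> clopen_upsets X \<Longrightarrow> U \<subseteq> points X"
  by (simp add: clopen_upsets_clopens clopens_subset)

lemma clopen_upsetsD:
  "U \<in> clopen_upsets X \<Longrightarrow> x \<in> U \<Longrightarrow> y \<in> points X \<Longrightarrow> ole X x y \<Longrightarrow> y \<in> U"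
  by (auto simp: clopen_upsets_def is_upset_def)

lemma empty_clopen_upsets: "{} \<in> clopen_upsets X"
  by (simp add: clopen_upsets_def empty_clopens is_upset_def)

lemma points_clopen_upsets: "points X \<in> clopen_upsets X"
  by (simp add: clopen_upsets_def clopens_points is_upset_def)

lemma clopen_upsets_Un: "U \<in> clopen_upsets X \<Longrightarrow> V \<in> clopen_upsets X \<Longrightarrow> U \<union> V \<in> clopen_upsets X"
  by (auto simp: clopen_upsets_def clopens_Un is_upset_def)

lemma clopen_upsets_Int: "U \<in> clopen_upsets X \<Longrightarrow> V \<in> clopen_upsets X \<Longrightarrow> U \<inter> V \<in> clopen_upsets X"
  by (auto simp: clopen_upsets_def clopens_Int is_upset_def)

lemmas clopen_upsets_intros =
  empty_clopen_upsets points_clopen_upsets clopen_upsets_Un clopen_upsets_Int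

text \<open>\<open>meet\<close> is a Hilbert choice among greatest lower bounds, so computing one
  needs antisymmetry to make the choice unique.\<close>

lemma (in partial_order) meet_equality:
  assumes "x \<in> carrier L" "y \<in> carrier L" "z \<in> carrier L" "z \<sqsubseteq> x" "z \<sqsubseteq> y"
    and "\<And>w. w \<in> carrier L \<Longrightarrow> w \<sqsubseteq> x \<Longrightarrow> w \<sqsubseteq> y \<Longrightarrow> w \<sqsubseteq> z"
  shows "greatest L z (Lower L {x, y})" "x \<sqinter> y = z"
proof -
  show *: "greatest L z (Lower L {x, y})"
    using assms by (auto simp: greatest_def Lower_def)
  show "x \<sqinter> y = z"
    unfolding meet_def inf_def
    using * by (rule some_equality) (metis * le_antisym greatest_closed greatest_le greatest_mem)
qed

lemma (in partial_order) join_equality: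
  assumes "x \<in> carrier L" "y \<in> carrier L" "z \<in> carrier L" "x \<sqsubseteq> z" "y \<sqsubseteq> z"
    and "\<And>w. w \<in> carrier L \<Longrightarrow> x \<sqsubseteq> w \<Longrightarrow> y \<sqsubseteq> w \<Longrightarrow> z \<sqsubseteq> w"
  shows "least L z (Upper L {x, y})" "x \<squnion> y = z"
proof -
  show *: "least L z (Upper L {x, y})"
    using assms by (auto simp: least_def Upper_def)
  show "x \<squnion> y = z"
    unfolding join_def sup_def
    using * by (rule some_equality) (metis * le_antisym least_closed least_le least_mem)
qed

section \<open>Lattice and Heyting operations of clopen upsets\<close>

context
  fixes Y :: "'a ospace"
begin

lemma carrier_upset_algebra: "carrier (upset_algebra Y) = clopen_upsets Y"
  by (simp add: upset_algebra_def clopen_upsets_def)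

lemma le_upset_algebra: "le (upset_algebra Y) = (\<subseteq>)"
  by (simp add: upset_algebra_def)

lemma imp_upset_algebra: "imp (upset_algebra Y) U V = points Y - downset Y (U - V)"
  by (simp add: upset_algebra_def)

interpretation partial_order "upset_algebra Y"
  by unfold_locales (auto simp: upset_algebra_def)

lemma upset_algebra_meet:
  assumes "U \<in> clopen_upsets Y" "V \<in> clopen_upsets Y"
  shows "greatest (upset_algebra Y) (U \<inter> V) (Lower (upset_algebra Y) {U, V})"
    "U \<sqinter>\<^bsub>upset_algebra Y\<^esub> V = U \<inter> V"
  using assms clopen_upsets_Int[OF assms]
  by - (rule meet_equality; auto simp: carrier_upset_algebra le_upset_algebra)+

lemma upset_algebra_join:
  assumes "U \<in> clopen_upsets Y" "V \<in> clopen_upsets Y"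
  shows "least (upset_algebra Y) (U \<union> V) (Upper (upset_algebra Y) {U, V})"
    "U \<squnion>\<^bsub>upset_algebra Y\<^esub> V = U \<union> V"
  using assms clopen_upsets_Un[OF assms]
  by - (rule join_equality; auto simp: carrier_upset_algebra le_upset_algebra)+

lemma bounded_lattice_upset_algebra: "bounded_lattice (upset_algebra Y)"
proof
  show "\<exists>s. least (upset_algebra Y) s (Upper (upset_algebra Y) {x, y})"
    if "x \<in> carrier (upset_algebra Y)" "y \<in> carrier (upset_algebra Y)" for x y
    using upset_algebra_join(1) that unfolding carrier_upset_algebra by blast
  show "\<exists>s. greatest (upset_algebra Y) s (Lower (upset_algebra Y) {x, y})"
    if "x \<in> carrier (upset_algebra Y)" "y \<in> carrier (upset_algebra Y)" for x y
    using upset_algebra_meet(1) that unfolding carrier_upset_algebra by blast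
  show "\<exists>x. least (upset_algebra Y) x (carrier (upset_algebra Y))"
    using empty_clopen_upsets[of Y] unfolding least_def carrier_upset_algebra le_upset_algebra
    by (intro exI[of _ "{}"]) auto
  show "\<exists>x. greatest (upset_algebra Y) x (carrier (upset_algebra Y))"
    using points_clopen_upsets[of Y] unfolding greatest_def carrier_upset_algebra le_upset_algebra
    by (intro exI[of _ "points Y"]) (auto dest: clopen_upsets_subset)
qed

lemma upset_algebra_bot: "\<bottom>\<^bsub>upset_algebra Y\<^esub> = {}"
proof -
  interpret bounded_lattice "upset_algebra Y" by (rule bounded_lattice_upset_algebra)
  show ?thesis
    by (rule bottom_eq[symmetric]) (auto simp: carrier_upset_algebra le_upset_algebra empty_clopen_upsets)
qed

lemma upset_algebra_top: "\<top>\<^bsub>upset_algebra Y\<^esub> = points Y"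
proof -
  interpret bounded_lattice "upset_algebra Y" by (rule bounded_lattice_upset_algebra)
  show ?thesis
    by (rule top_eq[symmetric])
      (auto simp: carrier_upset_algebra le_upset_algebra points_clopen_upsets dest: clopen_upsets_subset)
qed

lemmas upset_algebra_simps =
  carrier_upset_algebra le_upset_algebra imp_upset_algebra upset_algebra_meet(2)
  upset_algebra_join(2) upset_algebra_bot upset_algebra_top

text \<open>Residuation is a pointwise fact: as \<open>Z\<close> is an upset, it avoids the downset
  of \<open>U - V\<close> iff it avoids \<open>U - V\<close> itself. What a space has to supply is
  that the implication is again a clopen upset.\<close>

lemma heyting_upset_algebra:
  assumes refl: "\<And>x. x \<in> points Y \<Longrightarrow> ole Y x x"
    and imp: "\<And>U V. U \<in> clopen_upsets Y \<Longrightarrow> V \<in> clopen_upsets Y \<Longrightarrow>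
      points Y - downset Y (U - V) \<in> clopen_upsets Y"
  shows "heyting_algebra (upset_algebra Y)"
proof -
  interpret bounded_lattice "upset_algebra Y" by (rule bounded_lattice_upset_algebra)
  have "Z \<subseteq> points Y - downset Y (U - V) \<longleftrightarrow> Z \<inter> U \<subseteq> V"
    if "U \<in> clopen_upsets Y" "V \<in> clopen_upsets Y" "Z \<in> clopen_upsets Y" for U V Z
  proof
    assume "Z \<subseteq> points Y - downset Y (U - V)"
    then show "Z \<inter> U \<subseteq> V"
      using refl by (fastforce simp: downset_def)
  next
    assume ZU: "Z \<inter> U \<subseteq> V"
    then show "Z \<subseteq> points Y - downset Y (U - V)"
      using that(1,3) clopen_upsets_subset[OF that(1)] clopen_upsets_subset[OF that(3)]
        clopen_upsetsD[OF that(3)]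
      unfolding downset_def by blast
  qed
  then show ?thesis
    by unfold_locales (simp_all add: upset_algebra_simps imp)
qed

text \<open>A point in the downsets of both differences would lie below some \<open>y\<close> in
  \<open>U - V\<close> and some \<open>z\<close> in \<open>V - U\<close>. The root condition makes
  \<open>y\<close> and \<open>z\<close> comparable, and the larger of them would then lie in both
  upsets, a contradiction.\<close>

lemma godel_upset_algebra:
  assumes "heyting_algebra (upset_algebra Y)"
    and root: "\<And>x y z. x \<in> points Y \<Longrightarrow> y \<in> points Y \<Longrightarrow> z \<in> points Y \<Longrightarrow>
      ole Y x y \<Longrightarrow> ole Y x z \<Longrightarrow> ole Y y z \<or> ole Y z y"
  shows "godel_algebra (upset_algebra Y)"
proof -
  interpret heyting_algebra "upset_algebra Y" by fact
  have imp: "points Y - downset Y (U - V) \<in> clopen_upsets Y"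
    if "U \<in> clopen_upsets Y" "V \<in> clopen_upsets Y" for U V
    using imp_closed[of U V] that by (simp add: upset_algebra_simps)
  show ?thesis
  proof
    fix U V assume "U \<in> carrier (upset_algebra Y)" "V \<in> carrier (upset_algebra Y)"
    then have UV: "U \<in> clopen_upsets Y" "V \<in> clopen_upsets Y"
      by (simp_all add: carrier_upset_algebra)
    have "downset Y (U - V) \<inter> downset Y (V - U) = {}"
      using UV root by (auto simp: downset_def) (meson clopen_upsetsD clopen_upsets_subset subsetD)
    then show "imp (upset_algebra Y) U V \<squnion>\<^bsub>upset_algebra Y\<^esub> imp (upset_algebra Y) V U
      = \<top>\<^bsub>upset_algebra Y\<^esub>"
      using UV imp by (auto simp: upset_algebra_simps)
  qed
qed

end

section \<open>Priestley spaces: extremal points of closed chains and separation\<close>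

locale priestley_space =
  fixes X :: "'x ospace"
  assumes compact: "compact_space (otop X)"
    and refl: "x \<in> points X \<Longrightarrow> ole X x x"
    and trans: "ole X x y \<Longrightarrow> ole X y z \<Longrightarrow> x \<in> points X \<Longrightarrow> y \<in> points X \<Longrightarrow> z \<in> points X \<Longrightarrow>
      ole X x z"
    and antisym: "ole X x y \<Longrightarrow> ole X y x \<Longrightarrow> x \<in> points X \<Longrightarrow> y \<in> points X \<Longrightarrow> x = y"
    and separation: "x \<in> points X \<Longrightarrow> y \<in> points X \<Longrightarrow> \<not> ole X x y \<Longrightarrow>
      \<exists>U\<in>clopen_upsets X. x \<in> U \<and> y \<notin> U"
begin

lemma closedin_compactin: "closedin (otop X) D \<Longrightarrow> compactin (otop X) D"
  by (rule closedin_compact_space[OF compact])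

lemma closedin_up:
  assumes "x \<in> points X"
  shows "closedin (otop X) {y \<in> points X. ole X x y}"
proof -
  have "{y \<in> points X. ole X x y} = \<Inter> {U \<in> clopen_upsets X. x \<in> U}"
    using assms separation[OF assms] points_clopen_upsets[of X] by (auto dest: clopen_upsetsD)
  also have "closedin (otop X) \<dots>"
    using assms points_clopen_upsets[of X]
    by (intro closedin_Inter) (auto simp: clopen_upsets_def clopens_def)
  finally show ?thesis .
qed

lemma closedin_down:
  assumes "x \<in> points X"
  shows "closedin (otop X) {y \<in> points X. ole X y x}"
proof -
  have "{y \<in> points X. ole X y x} = \<Inter> {points X - U |U. U \<in> clopen_upsets X \<and> x \<notin> U}"
    using assms separation empty_clopen_upsets[of X]
    by (auto dest: clopen_upsetsD) blast+
  also have "closedin (otop X) \<dots>"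
    using empty_clopen_upsets[of X]
    by (intro closedin_Inter) (auto simp: clopen_upsets_def clopens_def)
  finally show ?thesis .
qed

text \<open>Without a least point, the complements of the sets \<open>{y. r y x}\<close> for
  \<open>x\<close> in \<open>C\<close> cover \<open>C\<close>. Totality of \<open>r\<close> makes
  them directed, so one of them covers \<open>C\<close>, yet it omits its own \<open>x\<close>. The
  relation is abstract so that the order and its converse both qualify.\<close>

lemma closed_chain_extremum:
  assumes C: "closedin (otop X) C" "C \<noteq> {}"
    and r: "\<And>x y. x \<in> C \<Longrightarrow> y \<in> C \<Longrightarrow> r x y \<or> r y x"
    and tr: "\<And>x y z. x \<in> points X \<Longrightarrow> y \<in> C \<Longrightarrow> z \<in> C \<Longrightarrow> r x y \<Longrightarrow> r y z \<Longrightarrow> r x z"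
    and closed: "\<And>x. x \<in> C \<Longrightarrow> closedin (otop X) {y \<in> points X. r y x}"
  shows "\<exists>m\<in>C. \<forall>x\<in>C. r m x"
proof (rule ccontr)
  assume no: "\<not> ?thesis"
  define \<U> where "\<U> = insert {} {points X - {y \<in> points X. r y x} |x. x \<in> C}"
  have CX: "C \<subseteq> points X"
    using C closedin_subset by blast
  have "\<exists>U\<in>\<U>. C \<subseteq> U"
  proof (rule compactin_directed[of "otop X" C \<U>])
    show "compactin (otop X) C"
      by (rule closedin_compactin) (rule C)
    show "{} \<in> \<U>"
      by (simp add: \<U>_def)
    show "openin (otop X) U" if "U \<in> \<U>" for U
      using that closed by (auto simp: \<U>_def)
    show "C \<subseteq> \<Union>\<U>"
    proof
      fix x assume x: "x \<in> C"
      then obtain y where y: "y \<in> C" "\<not> r x y"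
        using no by blast
      then have "x \<in> points X - {z \<in> points X. r z y}"
        using x CX by blast
      with y(1) show "x \<in> \<Union>\<U>"
        unfolding \<U>_def by blast
    qed
    have 1: "(points X - {y \<in> points X. r y u}) \<union> (points X - {y \<in> points X. r y v}) =
        points X - {y \<in> points X. r y u}" if "u \<in> C" "v \<in> C" "r u v" for u v
      using that tr by auto
    show "U \<union> V \<in> \<U>" if UV: "U \<in> \<U>" "V \<in> \<U>" for U V
    proof (cases "U = {} \<or> V = {}")
      case True
      with that show ?thesis by auto
    next
      case False
      then obtain u v where uv: "U = points X - {y \<in> points X. r y u}" "u \<in> C"
        "V = points X - {y \<in> points X. r y v}" "v \<in> C"
        using UV by (auto simp: \<U>_def)
      from r[OF uv(2,4)] have "U \<union> V = U \<or> U \<union> V = V"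
        using 1 uv by blast
      with UV show ?thesis by metis
    qed
  qed auto
  then show False
    using C(2) CX r by (auto simp: \<U>_def)
qed

lemma chainD:
  "Complete_Partial_Order.chain (ole X) C \<Longrightarrow> x \<in> C \<Longrightarrow> y \<in> C \<Longrightarrow> ole X x y \<or> ole X y x"
  by (auto simp: Complete_Partial_Order.chain_def)

lemma chain_least:
  assumes C: "closedin (otop X) C" "C \<noteq> {}" "Complete_Partial_Order.chain (ole X) C"
  obtains m where "m \<in> C" "\<And>x. x \<in> C \<Longrightarrow> ole X m x"
proof -
  have "C \<subseteq> points X"
    using C closedin_subset by blast
  then have "\<exists>m\<in>C. \<forall>x\<in>C. ole X m x"
    using C chainD[OF C(3)] closedin_down trans
    by (intro closed_chain_extremum[of C "\<lambda>x y. ole X x y"]) blast+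
  then show thesis using that by blast
qed

lemma chain_greatest:
  assumes C: "closedin (otop X) C" "C \<noteq> {}" "Complete_Partial_Order.chain (ole X) C"
  obtains m where "m \<in> C" "\<And>x. x \<in> C \<Longrightarrow> ole X x m"
proof -
  have "C \<subseteq> points X"
    using C closedin_subset by blast
  then have "\<exists>m\<in>C. \<forall>x\<in>C. ole X x m"
    using C chainD[OF C(3)] closedin_up trans
    by (intro closed_chain_extremum[of C "\<lambda>x y. ole X y x"]) blast+
  then show thesis using that by blast
qed

text \<open>Differences of clopen upsets separate points whichever way the order fails, and they are
  closed under finite intersection, since \<open>(V - W) \<inter> (V' - W') = (V \<inter> V') - (W
  \<union> W')\<close>. Hence the complements of those that contain \<open>c\<close> form a directed
  open cover of \<open>D\<close>.\<close>

lemma separate_closed: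
  assumes D: "closedin (otop X) D" and c: "c \<in> points X" "c \<notin> D"
  obtains V W where "V \<in> clopen_upsets X" "W \<in> clopen_upsets X" "c \<in> V - W" "D \<inter> (V - W) = {}"
proof -
  define \<U> where "\<U> = {points X - (V - W) |V W.
    V \<in> clopen_upsets X \<and> W \<in> clopen_upsets X \<and> c \<in> V - W}"
  have "\<exists>U\<in>\<U>. D \<subseteq> U"
  proof (rule compactin_directed[of "otop X" D \<U>])
    show "compactin (otop X) D"
      by (rule closedin_compactin) (rule D)
    show "openin (otop X) U" if "U \<in> \<U>" for U
      using that unfolding \<U>_def clopen_upsets_def clopens_def
      by (auto intro!: openin_diff closedin_diff)
    have "{} = points X - (points X - {})" by simp
    then show "{} \<in> \<U>"
      using c points_clopen_upsets[of X] empty_clopen_upsets[of X] unfolding \<U>_def by blast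
    show "U \<union> U' \<in> \<U>" if UV: "U \<in> \<U>" "U' \<in> \<U>" for U U'
    proof -
      obtain V W V' W' where *: "U = points X - (V - W)" "U' = points X - (V' - W')"
        "V \<in> clopen_upsets X" "W \<in> clopen_upsets X" "V' \<in> clopen_upsets X" "W' \<in> clopen_upsets X"
        "c \<in> V - W" "c \<in> V' - W'"
        using UV by (auto simp: \<U>_def)
      then have "U \<union> U' = points X - (V \<inter> V' - (W \<union> W'))" "c \<in> V \<inter> V' - (W \<union> W')" by auto
      with * show ?thesis
        unfolding \<U>_def by (blast intro: clopen_upsets_intros)
    qed
    show "D \<subseteq> \<Union>\<U>"
    proof
      fix d assume d: "d \<in> D"
      then have dX: "d \<in> points X" "d \<noteq> c"
        using D closedin_subset c by blast+
      then consider "\<not> ole X c d" | "\<not> ole X d c"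
        using antisym c by blast
      then obtain V W where "V \<in> clopen_upsets X" "W \<in> clopen_upsets X" "c \<in> V - W" "d \<notin> V - W"
      proof cases
        case 1
        then obtain V where "V \<in> clopen_upsets X" "c \<in> V" "d \<notin> V"
          using separation c dX by blast
        then show thesis
          using that[of V "{}"] empty_clopen_upsets by blast
      next
        case 2
        then obtain W where "W \<in> clopen_upsets X" "d \<in> W" "c \<notin> W"
          using separation c dX by blast
        then show thesis
          using that[of "points X" W] c points_clopen_upsets by blast
      qed
      then have "points X - (V - W) \<in> \<U>" "d \<in> points X - (V - W)"
        using dX by (auto simp: \<U>_def)
      then show "d \<in> \<Union>\<U>" by blast
    qed
  qed auto
  then obtain V W where "V \<in> clopen_upsets X" "W \<in> clopen_upsets X" "c \<in> V - W"
    "D \<subseteq> points X - (V - W)"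
    by (auto simp: \<U>_def)
  then show thesis
    using that[of V W] by blast
qed

text \<open>Used to see that a compact image inside the space is closed.\<close>

lemma Hausdorff: "Hausdorff_space (otop X)"
  unfolding Hausdorff_space_def disjnt_def
proof (intro allI impI, elim conjE)
  fix x y assume xy: "x \<in> points X" "y \<in> points X" "x \<noteq> y"
  then consider "\<not> ole X x y" | "\<not> ole X y x"
    using antisym by blast
  then obtain U where "U \<in> clopen_upsets X" "x \<in> U \<longleftrightarrow> y \<notin> U"
    using separation xy by (metis (no_types, lifting))
  then have "openin (otop X) U" "openin (otop X) (points X - U)" "x \<in> U \<longleftrightarrow> y \<notin> U"
    by (auto simp: clopen_upsets_def clopens_def)
  then show "\<exists>U V. openin (otop X) U \<and> openin (otop X) V \<and> x \<in> U \<and> y \<in> V \<and> U \<inter> V = {}"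
    using xy by (metis Diff_disjoint Diff_iff inf_commute)
qed

text \<open>By compactness a separating sublattice is everything: for a clopen upset \<open>U\<close> first find, for
  each of its points, an element below \<open>U\<close> containing the point, then finitely many of these cover \<open>U\<close>.\<close>

lemma separating_sublattice:
  assumes \<V>: "\<V> \<subseteq> clopen_upsets X" "{} \<in> \<V>" "points X \<in> \<V>"
    and Un: "\<And>U V. U \<in> \<V> \<Longrightarrow> V \<in> \<V> \<Longrightarrow> U \<union> V \<in> \<V>"
    and Int: "\<And>U V. U \<in> \<V> \<Longrightarrow> V \<in> \<V> \<Longrightarrow> U \<inter> V \<in> \<V>"
    and sep: "\<And>x y. x \<in> points X \<Longrightarrow> y \<in> points X \<Longrightarrow> \<not> ole X x y \<Longrightarrow> \<exists>U\<in>\<V>. x \<in> U \<and> y \<notin> U"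
  shows "clopen_upsets X \<subseteq> \<V>"
proof
  fix U assume U: "U \<in> clopen_upsets X"
  have clo: "openin (otop X) V" "closedin (otop X) V" if "V \<in> clopen_upsets X" for V
    using that by (auto simp: clopen_upsets_def clopens_def)
  have below: "\<exists>V\<in>\<V>. x \<in> V \<and> V \<subseteq> U" if x: "x \<in> U" for x
  proof -
    define \<U> where "\<U> = {points X - V |V. V \<in> \<V> \<and> x \<in> V}"
    have "\<exists>W\<in>\<U>. points X - U \<subseteq> W"
    proof (rule compactin_directed[of "otop X" "points X - U" \<U>])
      show "compactin (otop X) (points X - U)"
        using clo U by (intro closedin_compactin) blast
      show "openin (otop X) W" if "W \<in> \<U>" for W
        using that \<V>(1) clo unfolding \<U>_def by blast
      show "{} \<in> \<U>"
        using x \<V>(3) U clopen_upsets_subset unfolding \<U>_def by blast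
      show "W \<union> W' \<in> \<U>" if "W \<in> \<U>" "W' \<in> \<U>" for W W'
        using that Int unfolding \<U>_def by (auto simp flip: Diff_Int)
      show "points X - U \<subseteq> \<Union>\<U>"
      proof
        fix y assume y: "y \<in> points X - U"
        then have "\<not> ole X x y"
          using clopen_upsetsD[OF U x] by blast
        then obtain V where "V \<in> \<V>" "x \<in> V" "y \<notin> V"
          using sep[of x y] x y U clopen_upsets_subset by blast
        with y show "y \<in> \<Union>\<U>"
          unfolding \<U>_def by blast
      qed
    qed auto
    then obtain V where "V \<in> \<V>" "x \<in> V" "points X - U \<subseteq> points X - V"
      unfolding \<U>_def by blast
    then show ?thesis
      using \<V>(1) by (blast dest: clopen_upsets_subset)
  qed
  have "\<exists>W\<in>{V \<in> \<V>. V \<subseteq> U}. U \<subseteq> W"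
  proof (rule compactin_directed[of "otop X" U "{V \<in> \<V>. V \<subseteq> U}"])
    show "compactin (otop X) U"
      using clo U by (intro closedin_compactin) blast
    show "U \<subseteq> \<Union> {V \<in> \<V>. V \<subseteq> U}"
      using below by blast
  qed (use \<V> clo Un in auto)
  then show "U \<in> \<V>" by (metis (mono_tags) mem_Collect_eq subset_antisym)
qed

end

section \<open>Spaces of closed chains\<close>

text \<open>The topological and order-theoretic arguments see the tensor product only as a compact
  upset among the closed chains, so they are carried out for any such \<open>T\<close>.\<close>

locale chain_space = priestley_space X for X :: "'x ospace" +
  fixes T :: "'x set set"
  assumes T_chains: "T \<subseteq> closed_chains X"
    and T_upset: "C \<in> T \<Longrightarrow> D \<in> closed_chains X \<Longrightarrow> is_upset (ole X) C D \<Longrightarrow> D \<in> T"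
    and T_compact: "compactin (otop (CC X)) T"
begin

definition Y :: "'x set ospace" where
  "Y = \<lparr>otop = subtopology (otop (CC X)) T, ole = ole (CC X)\<rparr>"

lemma points_Y: "points Y = T"
  using T_chains points_CC[of X] by (auto simp: Y_def)

lemma ole_Y: "ole Y C D \<longleftrightarrow> is_upset (ole X) C D"
  by (simp add: Y_def CC_def)

lemma compact_Y: "compact_space (otop Y)"
  unfolding Y_def using compact_space_subtopology[OF T_compact] by simp

lemma T_D:
  assumes "C \<in> T"
  shows "C \<noteq> {}" "closedin (otop X) C" "C \<subseteq> points X" "Complete_Partial_Order.chain (ole X) C"
  using assms T_chains closedin_subset[of "otop X" C] by (auto simp: closed_chains_def)

lemma T_total: "C \<in> T \<Longrightarrow> x \<in> C \<Longrightarrow> y \<in> C \<Longrightarrow> ole X x y \<or> ole X y x"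
  using T_D(4) chainD by blast

text \<open>Principal upsets are the canonical elements above a chain: whenever some upset of
  \<open>C\<close> is to be found in \<open>T\<close>, the one generated by a suitable
  \<open>x\<close> is taken.\<close>

lemma up_in_T:
  assumes C: "C \<in> T" and x: "x \<in> C"
  shows "{y \<in> C. ole X x y} \<in> T" "ole Y C {y \<in> C. ole X x y}" "x \<in> {y \<in> C. ole X x y}"
proof -
  have "{y \<in> C. ole X x y} = C \<inter> {y \<in> points X. ole X x y}"
    using T_D(3)[OF C] by blast
  then have cl: "closedin (otop X) {y \<in> C. ole X x y}"
    using T_D[OF C] closedin_up x by auto
  show x': "x \<in> {y \<in> C. ole X x y}"
    using x refl T_D(3)[OF C] by blast
  show up: "ole Y C {y \<in> C. ole X x y}"
    using trans T_D(3)[OF C] x by (auto simp: ole_Y is_upset_def)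
  have "{y \<in> C. ole X x y} \<in> closed_chains X"
    using x' cl T_D(4)[OF C] by (auto simp: closed_chains_def Complete_Partial_Order.chain_def)
  then show "{y \<in> C. ole X x y} \<in> T"
    using T_upset[OF C] up by (simp add: ole_Y)
qed

text \<open>Both families are traces of generators, hence open. They are closed because the
  complement of a box is the diamond of the complement, and vice versa.\<close>

lemma box_clopen: "V \<in> clopens X \<Longrightarrow> {C \<in> T. C \<subseteq> V} \<in> clopens Y"
  and dia_clopen: "V \<in> clopens X \<Longrightarrow> {C \<in> T. C \<inter> V \<noteq> {}} \<in> clopens Y"
proof -
  have b: "openin (otop Y) {C \<in> T. C \<subseteq> V}" if "V \<in> clopens X" for V
  proof -
    have "openin (otop (CC X)) (Box X V)"
      using that by (auto simp: CC_def intro: topology_generated_by_Basis)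
    moreover have "{C \<in> T. C \<subseteq> V} = Box X V \<inter> T"
      using T_chains by (auto simp: Box_def)
    ultimately show ?thesis
      by (auto simp: Y_def openin_subtopology)
  qed
  have d: "openin (otop Y) {C \<in> T. C \<inter> V \<noteq> {}}" if "V \<in> clopens X" for V
  proof -
    have "openin (otop (CC X)) (Diamond X V)"
      using that by (auto simp: CC_def intro: topology_generated_by_Basis)
    moreover have "{C \<in> T. C \<inter> V \<noteq> {}} = Diamond X V \<inter> T"
      using T_chains by (auto simp: Diamond_def)
    ultimately show ?thesis
      by (auto simp: Y_def openin_subtopology)
  qed
  assume V: "V \<in> clopens X"
  have "T - {C \<in> T. C \<subseteq> V} = {C \<in> T. C \<inter> (points X - V) \<noteq> {}}"
    "T - {C \<in> T. C \<inter> V \<noteq> {}} = {C \<in> T. C \<subseteq> points X - V}"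
    using T_D(3) by blast+
  moreover have "points X - V \<in> clopens X"
    using V by (intro clopens_Diff clopens_points)
  ultimately show "{C \<in> T. C \<subseteq> V} \<in> clopens Y" "{C \<in> T. C \<inter> V \<noteq> {}} \<in> clopens Y"
    using b[of V] d[of V] b[of "points X - V"] d[of "points X - V"] V
    unfolding clopens_def closedin_def points_Y by simp_all
qed

section \<open>Order and downsets in the chain space\<close>

lemma ole_Y_refl: "C \<in> T \<Longrightarrow> ole Y C C"
  by (auto simp: ole_Y is_upset_def)

lemma ole_Y_trans: "ole Y A B \<Longrightarrow> ole Y B C \<Longrightarrow> ole Y A C"
  by (auto simp: ole_Y is_upset_def)

lemma ole_Y_root:
  assumes "C \<in> T" "ole Y C D" "ole Y C E"
  shows "ole Y D E \<or> ole Y E D"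
proof (cases "E \<subseteq> D")
  case True
  with assms show ?thesis by (auto simp: ole_Y is_upset_def)
next
  case False
  then obtain e where "e \<in> E" "e \<notin> D" by blast
  then have "d \<in> E" if "d \<in> D" for d
    using that assms T_total[of C d e] \<open>e \<in> E\<close> \<open>e \<notin> D\<close> unfolding ole_Y is_upset_def by blast
  then have "D \<subseteq> E" by blast
  with assms show ?thesis by (auto simp: ole_Y is_upset_def)
qed

text \<open>This is the downset of the set of chains that lie in \<open>V\<close> and meet
  \<open>W\<close>: an upset of \<open>C\<close> of that kind may be shrunk to the one generated by
  a point \<open>w\<close> of \<open>W\<close>.\<close>

definition eventually_in :: "'x set \<Rightarrow> 'x set \<Rightarrow> 'x set set" where
  "eventually_in V W = {C \<in> T. \<exists>w\<in>C \<inter> W. \<forall>y\<in>C. ole X w y \<longrightarrow> y \<in> V}"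

lemma openin_Y_I:
  assumes "S \<subseteq> T" "\<And>C. C \<in> S \<Longrightarrow> \<exists>N\<in>clopens Y. C \<in> N \<and> N \<subseteq> S"
  shows "openin (otop Y) S"
  by (subst openin_subopen) (use assms(2) in \<open>auto simp: clopens_def\<close>)

lemma closed_chain_Int:
  assumes "C \<in> T" "V \<in> clopens X"
  shows "closedin (otop X) (C \<inter> V)" "Complete_Partial_Order.chain (ole X) (C \<inter> V)"
  using T_D[OF assms(1)] assms(2) by (auto simp: clopens_def Complete_Partial_Order.chain_def)

text \<open>Only the greatest point \<open>m\<close> of \<open>C - V\<close> matters. As
  \<open>w\<close> is not below \<open>m\<close>, some clopen upset \<open>U\<close> contains
  \<open>w\<close> and not \<open>m\<close>, so it misses all of \<open>C - V\<close>. The chains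
  that meet \<open>W \<inter> U\<close> and avoid \<open>U - V\<close> form a neighbourhood of
  \<open>C\<close>, and in each of them any point of \<open>W \<inter> U\<close> is a
  witness.\<close>

lemma eventually_in_open:
  assumes V: "V \<in> clopens X" and W: "W \<in> clopens X"
  shows "openin (otop Y) (eventually_in V W)"
proof (rule openin_Y_I)
  fix C assume "C \<in> eventually_in V W"
  then obtain w where C: "C \<in> T" and w: "w \<in> C" "w \<in> W" and above: "\<And>y. y \<in> C \<Longrightarrow> ole X w y \<Longrightarrow> y \<in> V"
    by (auto simp: eventually_in_def)
  note CX = T_D(3)[OF C]
  obtain U where U: "U \<in> clopen_upsets X" "w \<in> U" "C \<inter> U \<subseteq> V"
  proof (cases "C \<subseteq> V")
    case True
    then show thesis
      using that[OF points_clopen_upsets] w CX by blast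
  next
    case False
    have "C - V = C \<inter> (points X - V)"
      using CX by blast
    then obtain m where m: "m \<in> C - V" and m_max: "\<And>x. x \<in> C - V \<Longrightarrow> ole X x m"
      using chain_greatest[of "C - V"] closed_chain_Int[OF C, of "points X - V"] False V
      by (metis Diff_eq_empty_iff clopens_Diff clopens_points)
    then obtain U where U: "U \<in> clopen_upsets X" "w \<in> U" "m \<notin> U"
      using separation[of w m] above w CX by blast
    have "C \<inter> U \<subseteq> V"
      using clopen_upsetsD[OF U(1)] m m_max U(3) CX by blast
    with U show thesis by (intro that)
  qed
  define N where "N = {C \<in> T. C \<inter> (W \<inter> U) \<noteq> {}} \<inter> {C \<in> T. C \<subseteq> V \<union> (points X - U)}"
  have "N \<in> clopens Y"
    unfolding N_def using V W clopen_upsets_clopens[OF U(1)]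
    by (intro clopens_Int box_clopen dia_clopen clopens_Un clopens_Diff clopens_points)
  moreover have "C \<in> N"
    using C U w CX by (auto simp: N_def)
  moreover have "N \<subseteq> eventually_in V W"
  proof
    fix D assume "D \<in> N"
    then obtain d where D: "D \<in> T" "D \<subseteq> V \<union> (points X - U)" and d: "d \<in> D" "d \<in> W" "d \<in> U"
      by (auto simp: N_def)
    then have "\<forall>y\<in>D. ole X d y \<longrightarrow> y \<in> V"
      using clopen_upsetsD[OF U(1)] T_D(3) by blast
    with D d show "D \<in> eventually_in V W"
      by (auto simp: eventually_in_def)
  qed
  ultimately show "\<exists>N\<in>clopens Y. C \<in> N \<and> N \<subseteq> eventually_in V W" by blast
qed (auto simp: eventually_in_def)

text \<open>By reflexivity a witness lies in \<open>W \<inter> V\<close>, so if \<open>C\<close>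
  misses this set, its neighbours have no witness either. Otherwise the greatest candidate
  \<open>m\<close> of \<open>C\<close> fails because of some \<open>y\<close> above it outside
  \<open>V\<close>, and a clopen upset \<open>U\<close> with \<open>y\<close> but not
  \<open>m\<close> contains no candidate of \<open>C\<close>. Meeting \<open>U - V\<close> and
  avoiding \<open>W \<inter> V \<inter> U\<close> is then a clopen condition that keeps every
  candidate from being a witness.\<close>

lemma eventually_in_closed:
  assumes V: "V \<in> clopens X" and W: "W \<in> clopens X"
  shows "closedin (otop Y) (eventually_in V W)"
  unfolding closedin_def points_Y
proof
  show "openin (otop Y) (T - eventually_in V W)"
  proof (rule openin_Y_I)
    fix C assume "C \<in> T - eventually_in V W"
    then have C: "C \<in> T" and above: "\<And>w. w \<in> C \<Longrightarrow> w \<in> W \<Longrightarrow> \<exists>y\<in>C. ole X w y \<and> y \<notin> V"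
      by (auto simp: eventually_in_def)
    note CX = T_D(3)[OF C]
    show "\<exists>N\<in>clopens Y. C \<in> N \<and> N \<subseteq> T - eventually_in V W"
    proof (cases "C \<inter> (W \<inter> V) = {}")
      case True
      define N where "N = {C \<in> T. C \<subseteq> points X - W \<inter> V}"
      have "N \<in> clopens Y"
        unfolding N_def using V W by (intro box_clopen clopens_intros)
      moreover have "C \<in> N"
        using C True CX by (auto simp: N_def)
      moreover have "N \<subseteq> T - eventually_in V W"
        using refl T_D(3) by (fastforce simp: N_def eventually_in_def)
      ultimately show ?thesis by blast
    next
      case False
      then obtain m where m: "m \<in> C" "m \<in> W" "m \<in> V" and m_max: "\<And>x. x \<in> C \<inter> (W \<inter> V) \<Longrightarrow> ole X x m"
        using chain_greatest[of "C \<inter> (W \<inter> V)"] closed_chain_Int[OF C, of "W \<inter> V"] clopens_Int[OF W V]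
        by (metis IntE)
      then obtain y where y: "y \<in> C" "ole X m y" "y \<notin> V"
        using above by blast
      then have "\<not> ole X y m"
        using antisym m CX by blast
      then obtain U where U: "U \<in> clopen_upsets X" "y \<in> U" "m \<notin> U"
        using separation y m CX by blast
      define N where "N = {C \<in> T. C \<inter> (U - V) \<noteq> {}} \<inter> {C \<in> T. C \<subseteq> points X - (W \<inter> V \<inter> U)}"
      have "N \<in> clopens Y"
        unfolding N_def using V W clopen_upsets_clopens[OF U(1)]
        by (intro clopens_Int box_clopen dia_clopen clopens_Diff clopens_points)
      moreover have "C \<in> N"
        using C CX U y clopen_upsetsD[OF U(1)] m m_max by (auto simp: N_def)
      moreover have "N \<subseteq> T - eventually_in V W"
      proof
        fix D assume "D \<in> N"
        then obtain d where D: "D \<in> T" "D \<subseteq> points X - (W \<inter> V \<inter> U)" and d: "d \<in> D" "d \<in> U" "d \<notin> V"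
          by (auto simp: N_def)
        \<comment> \<open>A candidate outside \<open>U\<close> cannot be above \<open>d\<close>, so
          it is below \<open>d\<close>, and \<open>d\<close> lies outside \<open>V\<close>.\<close>
        have "\<exists>y\<in>D. ole X w y \<and> y \<notin> V" if w: "w \<in> D" "w \<in> W" for w
        proof (cases "w \<in> V")
          case True
          then have "\<not> ole X d w"
            using D w d clopen_upsetsD[OF U(1)] by blast
          then show ?thesis
            using T_total[OF D(1)] d w by blast
        next
          case False
          then show ?thesis
            using refl w T_D(3)[OF D(1)] by blast
        qed
        with D show "D \<in> T - eventually_in V W"
          by (auto simp: eventually_in_def)
      qed
      ultimately show ?thesis by blast
    qed
  qed auto
qed (auto simp: eventually_in_def)

lemma eventually_in_clopen:
  "V \<in> clopens X \<Longrightarrow> W \<in> clopens X \<Longrightarrow> eventually_in V W \<in> clopens Y"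
  by (simp add: clopens_def eventually_in_open eventually_in_closed)

text \<open>Finite intersections of subbasic sets; one box suffices because boxes preserve
  intersections.\<close>

definition basic :: "'x set \<Rightarrow> 'x set set \<Rightarrow> 'x set set" where
  "basic V \<F> = {C \<in> T. C \<subseteq> V \<and> (\<forall>W\<in>\<F>. C \<inter> W \<noteq> {})}"

lemma openin_Y_basic:
  assumes "openin (otop Y) S" "C \<in> S"
  shows "\<exists>V \<F>. V \<in> clopens X \<and> finite \<F> \<and> \<F> \<subseteq> clopens X \<and> C \<in> basic V \<F> \<and> basic V \<F> \<subseteq> S"
proof -
  obtain S' where S': "openin (otop (CC X)) S'" "S = S' \<inter> T"
    using assms by (auto simp: Y_def openin_subtopology)
  have "generate_topology_on (Box X ` clopens X \<union> Diamond X ` clopens X) S'"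
    using S' by (simp add: CC_def openin_topology_generated_by_iff)
  then have "\<forall>C\<in>S' \<inter> T. \<exists>V \<F>. V \<in> clopens X \<and> finite \<F> \<and> \<F> \<subseteq> clopens X \<and>
    C \<in> basic V \<F> \<and> basic V \<F> \<subseteq> S' \<inter> T"
  proof induction
    case Empty
    then show ?case by simp
  next
    case (Int a b)
    show ?case
    proof
      fix C assume "C \<in> (a \<inter> b) \<inter> T"
      then obtain V \<F> V' \<F>' where *: "V \<in> clopens X" "finite \<F>" "\<F> \<subseteq> clopens X" "C \<in> basic V \<F>"
        "basic V \<F> \<subseteq> a \<inter> T" "V' \<in> clopens X" "finite \<F>'" "\<F>' \<subseteq> clopens X" "C \<in> basic V' \<F>'"
        "basic V' \<F>' \<subseteq> b \<inter> T"
        using Int.IH by (metis IntE IntI)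
      have "basic (V \<inter> V') (\<F> \<union> \<F>') = basic V \<F> \<inter> basic V' \<F>'"
        by (auto simp: basic_def)
      with * show "\<exists>V \<F>. V \<in> clopens X \<and> finite \<F> \<and> \<F> \<subseteq> clopens X \<and>
          C \<in> basic V \<F> \<and> basic V \<F> \<subseteq> (a \<inter> b) \<inter> T"
        by (intro exI[of _ "V \<inter> V'"] exI[of _ "\<F> \<union> \<F>'"]) (auto intro: clopens_Int)
    qed
  next
    case (UN K)
    show ?case
    proof
      fix C assume "C \<in> \<Union>K \<inter> T"
      then obtain k where k: "k \<in> K" "C \<in> k \<inter> T" by blast
      then obtain V \<F> where "V \<in> clopens X" "finite \<F>" "\<F> \<subseteq> clopens X" "C \<in> basic V \<F>" "basic V \<F> \<subseteq> k \<inter> T"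
        using UN.IH by metis
      with k(1) show "\<exists>V \<F>. V \<in> clopens X \<and> finite \<F> \<and> \<F> \<subseteq> clopens X \<and>
          C \<in> basic V \<F> \<and> basic V \<F> \<subseteq> \<Union>K \<inter> T"
        by (intro exI[of _ V] exI[of _ \<F>]) blast
    qed
  next
    case (Basis s)
    then consider V where "V \<in> clopens X" "s = Box X V" | V where "V \<in> clopens X" "s = Diamond X V"
      by blast
    then show ?case
    proof cases
      case 1
      have "basic V {} = s \<inter> T"
        using T_chains 1 by (auto simp: basic_def Box_def)
      then show ?thesis
        using 1 by (intro ballI exI[of _ V] exI[of _ "{}"]) auto
    next
      case 2
      have "basic (points X) {V} = s \<inter> T"
        using T_chains T_D(3) 2 by (auto simp: basic_def Diamond_def)
      then show ?thesis
        using 2 clopens_points by (intro ballI exI[of _ "points X"] exI[of _ "{V}"]) auto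
    qed
  qed
  then show ?thesis
    using assms(2) S'(2) by blast
qed

text \<open>Along a chain, finitely many witnesses of \<^const>\<open>eventually_in\<close> have a least one, and it
  works for all of them.\<close>

lemma downset_basic:
  assumes "finite \<F>"
  shows "downset Y (basic V \<F>) = (\<Inter>W\<in>insert (points X) \<F>. eventually_in V W)"
proof
  show "downset Y (basic V \<F>) \<subseteq> (\<Inter>W\<in>insert (points X) \<F>. eventually_in V W)"
  proof
    fix C assume "C \<in> downset Y (basic V \<F>)"
    then obtain D where C: "C \<in> T" and D: "D \<in> basic V \<F>" and up: "is_upset (ole X) C D"
      by (auto simp: downset_def points_Y ole_Y)
    have DV: "D \<subseteq> V" and DW: "D \<inter> W \<noteq> {}" if "W \<in> insert (points X) \<F>" for W
      using that D T_D(1)[of D] T_D(3)[of D] unfolding basic_def by blast+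
    have "C \<in> eventually_in V W" if W: "W \<in> insert (points X) \<F>" for W
    proof -
      obtain w where "w \<in> D" "w \<in> W"
        using DW[OF W] by blast
      with C up DV[OF W] show ?thesis
        unfolding eventually_in_def is_upset_def by blast
    qed
    then show "C \<in> (\<Inter>W\<in>insert (points X) \<F>. eventually_in V W)" by blast
  qed
next
  show "(\<Inter>W\<in>insert (points X) \<F>. eventually_in V W) \<subseteq> downset Y (basic V \<F>)"
  proof
    fix C assume *: "C \<in> (\<Inter>W\<in>insert (points X) \<F>. eventually_in V W)"
    then have "C \<in> eventually_in V (points X)" by blast
    then have C: "C \<in> T" and C0: "\<exists>w\<in>C. \<forall>y\<in>C. ole X w y \<longrightarrow> y \<in> V"
      unfolding eventually_in_def by blast+
    have "\<exists>w\<in>C. (\<forall>y\<in>C. ole X w y \<longrightarrow> y \<in> V) \<and> (\<forall>W\<in>\<F>'. \<exists>u\<in>C \<inter> W. ole X w u)"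
      if "finite \<F>'" "\<F>' \<subseteq> \<F>" for \<F>'
      using that
    proof induction
      case empty
      then show ?case
        using C0 by simp
    next
      case (insert W \<F>')
      then obtain w where w: "w \<in> C" "\<forall>y\<in>C. ole X w y \<longrightarrow> y \<in> V" "\<forall>W\<in>\<F>'. \<exists>u\<in>C \<inter> W. ole X w u"
        by auto
      have "C \<in> eventually_in V W"
        using * insert.prems by blast
      then obtain w' where w': "w' \<in> C \<inter> W" "\<forall>y\<in>C. ole X w' y \<longrightarrow> y \<in> V"
        unfolding eventually_in_def by blast
      show ?case
      proof (cases "ole X w w'")
        case True
        with w w' show ?thesis by blast
      next
        case False
        then have "ole X w' w"
          using T_total[OF C] w w' by blast
        then have "\<forall>V\<in>\<F>'. \<exists>u\<in>C \<inter> V. ole X w' u"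
          using w w' trans T_D(3)[OF C] by (meson IntD1 subsetD)
        moreover have "ole X w' w'"
          using w' refl T_D(3)[OF C] by blast
        ultimately show ?thesis
          using w' by blast
      qed
    qed
    from this[OF assms order_refl] obtain w where w: "w \<in> C" "\<And>y. y \<in> C \<Longrightarrow> ole X w y \<Longrightarrow> y \<in> V"
      "\<And>W. W \<in> \<F> \<Longrightarrow> \<exists>u\<in>C \<inter> W. ole X w u"
      by blast
    have "{y \<in> C. ole X w y} \<in> basic V \<F>"
      using w up_in_T(1)[OF C w(1)] unfolding basic_def by fast
    then show "C \<in> downset Y (basic V \<F>)"
      using up_in_T(2)[OF C w(1)] C by (auto simp: downset_def points_Y)
  qed
qed

lemma downset_basic_clopen:
  assumes "finite \<F>" "\<F> \<subseteq> clopens X" "V \<in> clopens X"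
  shows "downset Y (basic V \<F>) \<in> clopens Y"
proof -
  have "(\<Inter>W\<in>insert (points X) \<F>'. eventually_in V W) \<in> clopens Y"
    if "finite \<F>'" "\<F>' \<subseteq> clopens X" for \<F>'
    using that
  proof induction
    case empty
    then show ?case
      using eventually_in_clopen[OF assms(3) clopens_points] by simp
  next
    case (insert W \<F>')
    have "(\<Inter>W\<in>insert (points X) (insert W \<F>'). eventually_in V W) =
      eventually_in V W \<inter> (\<Inter>W\<in>insert (points X) \<F>'. eventually_in V W)" by blast
    then show ?case
      using insert eventually_in_clopen[OF assms(3)] by (metis clopens_Int insert_subset)
  qed
  then show ?thesis
    using assms by (simp add: downset_basic)
qed

lemma basic_open:
  assumes "finite \<F>" "\<F> \<subseteq> clopens X" "V \<in> clopens X"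
  shows "openin (otop Y) (basic V \<F>)"
  using assms(1,2)
proof induction
  case empty
  then show ?case
    using box_clopen[OF assms(3)] by (simp add: basic_def clopens_def)
next
  case (insert W \<F>)
  have "basic V (insert W \<F>) = {C \<in> T. C \<inter> W \<noteq> {}} \<inter> basic V \<F>"
    by (auto simp: basic_def)
  then show ?case
    using insert dia_clopen by (auto simp: clopens_def)
qed

text \<open>Downsets commute with unions, and by compactness \<open>A\<close> is a finite union of
  sets \<open>basic V \<F>\<close>. The directed family consists of the open parts of
  \<open>A\<close> whose downset is already known to be clopen.\<close>

lemma downset_clopen:
  assumes "A \<in> clopens Y"
  shows "downset Y A \<in> clopens Y"
proof -
  define \<U> where "\<U> = {B. openin (otop Y) B \<and> B \<subseteq> A \<and> downset Y B \<in> clopens Y}"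
  have "\<exists>B\<in>\<U>. A \<subseteq> B"
  proof (rule compactin_directed[of "otop Y" A \<U>])
    show "compactin (otop Y) A"
      using assms closedin_compact_space[OF compact_Y] by (simp add: clopens_def)
    have "downset Y {} = {}" "\<And>B B'. downset Y (B \<union> B') = downset Y B \<union> downset Y B'"
      by (auto simp: downset_def)
    then show "{} \<in> \<U>" "\<And>B B'. B \<in> \<U> \<Longrightarrow> B' \<in> \<U> \<Longrightarrow> B \<union> B' \<in> \<U>"
      by (auto simp: \<U>_def empty_clopens clopens_Un)
    show "A \<subseteq> \<Union>\<U>"
    proof
      fix C assume "C \<in> A"
      then obtain V \<F> where B: "V \<in> clopens X" "finite \<F>" "\<F> \<subseteq> clopens X" "C \<in> basic V \<F>" "basic V \<F> \<subseteq> A"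
        using openin_Y_basic[of A C] assms by (auto simp: clopens_def)
      have "basic V \<F> \<in> \<U>"
        using basic_open[OF B(2,3,1)] downset_basic_clopen[OF B(2,3,1)] B(5) by (simp add: \<U>_def)
      with B(4) show "C \<in> \<Union>\<U>" by blast
    qed
    show "openin (otop Y) B" if "B \<in> \<U>" for B
      using that by (simp add: \<U>_def)
  qed blast
  then obtain B where B: "B \<in> \<U>" "A \<subseteq> B" by blast
  then have "B = A"
    unfolding \<U>_def by blast
  with B show ?thesis
    by (simp add: \<U>_def)
qed

lemma imp_clopen_upset:
  assumes "U \<in> clopen_upsets Y" "V \<in> clopen_upsets Y"
  shows "T - downset Y (U - V) \<in> clopen_upsets Y"
proof -
  have "T - downset Y (U - V) \<in> clopens Y"
    using assms downset_clopen clopens_points[of Y] unfolding points_Y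
    by (intro clopens_Diff) (auto intro: clopen_upsets_clopens clopens_Diff)
  moreover have "is_upset (ole Y) T (T - downset Y (U - V))"
    using ole_Y_trans unfolding is_upset_def downset_def points_Y by blast
  ultimately show ?thesis
    by (simp add: clopen_upsets_def points_Y)
qed

lemma heyting_Y: "heyting_algebra (upset_algebra Y)"
  using heyting_upset_algebra[of Y] ole_Y_refl imp_clopen_upset by (simp add: points_Y)

lemma godel_Y: "godel_algebra (upset_algebra Y)"
  using godel_upset_algebra[OF heyting_Y] ole_Y_root by (auto simp: points_Y)

section \<open>Generation of the clopen upsets by boxes and implications\<close>

lemma box_upset: "V \<in> clopens X \<Longrightarrow> {C \<in> T. C \<subseteq> V} \<in> clopen_upsets Y"
  using box_clopen by (auto simp: clopen_upsets_def is_upset_def ole_Y points_Y)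

text \<open>As \<open>V\<close> is an upset, a point of \<open>C \<inter> V\<close> outside
  \<open>W\<close> generates an upset of \<open>C\<close> that lies in the box of \<open>V\<close>
  but not in that of \<open>W\<close>. The implication of two boxes can thus test whether a chain
  avoids \<open>V - W\<close>, which need not be an upset.\<close>

lemma imp_box:
  assumes V: "V \<in> clopen_upsets X" and W: "W \<in> clopen_upsets X"
  shows "T - downset Y ({C \<in> T. C \<subseteq> V} - {C \<in> T. C \<subseteq> W}) = {C \<in> T. C \<inter> V \<subseteq> W}"
proof -
  have "C \<in> downset Y ({C \<in> T. C \<subseteq> V} - {C \<in> T. C \<subseteq> W}) \<longleftrightarrow> \<not> C \<inter> V \<subseteq> W" if C: "C \<in> T" for C
  proof
    assume "C \<in> downset Y ({C \<in> T. C \<subseteq> V} - {C \<in> T. C \<subseteq> W})"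
    then show "\<not> C \<inter> V \<subseteq> W"
      by (auto simp: downset_def ole_Y is_upset_def)
  next
    assume "\<not> C \<inter> V \<subseteq> W"
    then obtain c where c: "c \<in> C" "c \<in> V" "c \<notin> W" by blast
    have "{y \<in> C. ole X c y} \<subseteq> V"
      using clopen_upsetsD[OF V c(2)] T_D(3)[OF C] by blast
    then show "C \<in> downset Y ({C \<in> T. C \<subseteq> V} - {C \<in> T. C \<subseteq> W})"
      using up_in_T[OF C c(1)] c C unfolding downset_def points_Y by blast
  qed
  then show ?thesis by blast
qed

text \<open>Points \<open>v\<close> outside \<open>V\<close> and \<open>w\<close> outside
  \<open>W\<close> of one chain are comparable, with \<open>v\<close> in \<open>W\<close> and
  \<open>w\<close> in \<open>V\<close>; the larger one would lie in both upsets, against its choice.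
  This is why joins survive the passage to boxes, which fails for arbitrary sets.\<close>

lemma box_Un:
  assumes "V \<in> clopen_upsets X" "W \<in> clopen_upsets X"
  shows "{C \<in> T. C \<subseteq> V \<union> W} = {C \<in> T. C \<subseteq> V} \<union> {C \<in> T. C \<subseteq> W}"
proof -
  have "C \<subseteq> V \<or> C \<subseteq> W" if C: "C \<in> T" "C \<subseteq> V \<union> W" for C
  proof (rule ccontr)
    assume "\<not> (C \<subseteq> V \<or> C \<subseteq> W)"
    then obtain v w where vw: "v \<in> C" "w \<in> C" "v \<notin> V" "w \<notin> W" by blast
    then have "v \<in> W" "w \<in> V" "v \<in> points X" "w \<in> points X"
      using C(2) T_D(3)[OF C(1)] by auto
    with vw show False
      using T_total[OF C(1) vw(1,2)] clopen_upsetsD[OF assms(1), of w v] clopen_upsetsD[OF assms(2), of v w]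
      by blast
  qed
  then show ?thesis by blast
qed

context
  fixes P :: "'x set set \<Rightarrow> bool"
  assumes P_box: "\<And>V. V \<in> clopen_upsets X \<Longrightarrow> P {C \<in> T. C \<subseteq> V}"
    and P_imp: "\<And>U V. U \<in> clopen_upsets Y \<Longrightarrow> V \<in> clopen_upsets Y \<Longrightarrow> P U \<Longrightarrow> P V \<Longrightarrow>
      P (T - downset Y (U - V))"
begin

text \<open>If \<open>D\<close> has a point outside \<open>C\<close>, then closedness of
  \<open>C\<close> gives a set \<open>V - W\<close> around it that \<open>C\<close> avoids, and the
  implication of boxes separates. If \<open>D\<close> is a subset of \<open>C\<close> but not an
  upset of it, some \<open>d\<close> in \<open>D\<close> lies below some \<open>c\<close> in
  \<open>C - D\<close>. An upset of \<open>C\<close> that avoids a neighbourhood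
  \<open>V - W\<close> of \<open>c\<close> consists of points above \<open>c\<close>, so it lies in
  every clopen upset \<open>A\<close> around \<open>c\<close>; but \<open>D\<close> avoids a
  suitable \<open>V - W\<close> and has the point \<open>d\<close> outside a suitable
  \<open>A\<close>. The predicate \<open>P\<close> records how the separating set was built, and the
  constant predicate \<open>True\<close> yields plain Priestley separation.\<close>

lemma generated_separation:
  assumes C: "C \<in> T" and D: "D \<in> T" and CD: "\<not> ole Y C D"
  shows "\<exists>U\<in>clopen_upsets Y. P U \<and> C \<in> U \<and> D \<notin> U"
proof -
  have *: "{C \<in> T. C \<inter> V \<subseteq> W} \<in> clopen_upsets Y \<and> P {C \<in> T. C \<inter> V \<subseteq> W}"
    if "V \<in> clopen_upsets X" "W \<in> clopen_upsets X" for V W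
  proof -
    have "{C \<in> T. C \<subseteq> V} \<in> clopen_upsets Y" "{C \<in> T. C \<subseteq> W} \<in> clopen_upsets Y"
      using that by (auto intro: box_upset clopen_upsets_clopens)
    then show ?thesis
      using P_imp P_box imp_clopen_upset that unfolding imp_box[OF that, symmetric] by blast
  qed
  note CX = T_D(3)[OF C] and DX = T_D(3)[OF D]
  show ?thesis
  proof (cases "D \<subseteq> C")
    case False
    then obtain d where d: "d \<in> D" "d \<notin> C" by blast
    obtain V W where VW: "V \<in> clopen_upsets X" "W \<in> clopen_upsets X" "d \<in> V - W" "C \<inter> (V - W) = {}"
      using separate_closed[OF T_D(2)[OF C], of d] d DX by blast
    then show ?thesis
      using *[OF VW(1,2)] C d by (intro bexI[of _ "{C \<in> T. C \<inter> V \<subseteq> W}"]) auto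
  next
    case True
    then obtain d c where dc: "d \<in> D" "c \<in> C" "ole X d c" "c \<notin> D"
      using CD by (auto simp: ole_Y is_upset_def)
    obtain V W where VW: "V \<in> clopen_upsets X" "W \<in> clopen_upsets X" "c \<in> V - W" "D \<inter> (V - W) = {}"
      using separate_closed[OF T_D(2)[OF D], of c] dc CX by blast
    have "\<not> ole X c d"
      using dc antisym CX DX by blast
    then obtain A where A: "A \<in> clopen_upsets X" "c \<in> A" "d \<notin> A"
      using separation dc CX DX by blast
    let ?U = "{C \<in> T. C \<inter> V \<subseteq> W}" and ?B = "{C \<in> T. C \<subseteq> A}"
    have "D \<in> downset Y (?U - ?B)"
      using D dc A VW ole_Y_refl[OF D] by (auto simp: downset_def points_Y)
    moreover have "C \<notin> downset Y (?U - ?B)"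
    proof
      assume "C \<in> downset Y (?U - ?B)"
      then obtain E e where E: "is_upset (ole X) C E" "E \<inter> V \<subseteq> W" "e \<in> E" "e \<notin> A"
        by (auto simp: downset_def ole_Y)
      then have "e \<in> C" "c \<notin> E"
        using VW by (auto simp: is_upset_def)
      then have "ole X c e"
        using T_total[OF C, of c e] E dc by (auto simp: is_upset_def)
      then show False
        using clopen_upsetsD[OF A(1,2)] E \<open>e \<in> C\<close> CX by blast
    qed
    ultimately show ?thesis
      using *[OF VW(1,2)] box_upset[OF clopen_upsets_clopens[OF A(1)]] P_box[OF A(1)] C D P_imp imp_clopen_upset
      by (intro bexI[of _ "T - downset Y (?U - ?B)"]) auto
  qed
qed

end

sublocale Y: priestley_space Y
proof
  show "compact_space (otop Y)" by (rule compact_Y)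
  show "\<exists>U\<in>clopen_upsets Y. C \<in> U \<and> D \<notin> U"
    if "C \<in> points Y" "D \<in> points Y" "\<not> ole Y C D" for C D
    using that generated_separation[of "\<lambda>_. True" C D] by (auto simp: points_Y)
qed (auto simp: ole_Y points_Y is_upset_def)

text \<open>The clopen upsets with property \<open>P\<close> form a sublattice that separates points
  by \<open>generated_separation\<close>, so compactness of the chain space leaves no others. The
  bounds are the boxes of the empty set and of the whole space.\<close>

theorem upset_algebra_induct:
  assumes "U \<in> clopen_upsets Y"
    and box: "\<And>V. V \<in> clopen_upsets X \<Longrightarrow> P {C \<in> T. C \<subseteq> V}"
    and imp: "\<And>U V. U \<in> clopen_upsets Y \<Longrightarrow> V \<in> clopen_upsets Y \<Longrightarrow> P U \<Longrightarrow> P V \<Longrightarrow>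
      P (T - downset Y (U - V))"
    and Un: "\<And>U V. U \<in> clopen_upsets Y \<Longrightarrow> V \<in> clopen_upsets Y \<Longrightarrow> P U \<Longrightarrow> P V \<Longrightarrow> P (U \<union> V)"
    and Int: "\<And>U V. U \<in> clopen_upsets Y \<Longrightarrow> V \<in> clopen_upsets Y \<Longrightarrow> P U \<Longrightarrow> P V \<Longrightarrow> P (U \<inter> V)"
  shows "P U"
proof -
  have *: "{C \<in> T. C \<subseteq> {}} = {}" "{C \<in> T. C \<subseteq> points X} = points Y"
    using T_D by (auto simp: points_Y)
  have "P {}" "P (points Y)"
    using box[OF empty_clopen_upsets] box[OF points_clopen_upsets] unfolding * by simp_all
  then have "clopen_upsets Y \<subseteq> {U \<in> clopen_upsets Y. P U}"
  proof (intro Y.separating_sublattice)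
    show "\<exists>U\<in>{U \<in> clopen_upsets Y. P U}. C \<in> U \<and> D \<notin> U"
      if "C \<in> points Y" "D \<in> points Y" "\<not> ole Y C D" for C D
      using generated_separation[of P, OF box imp] that unfolding points_Y by blast
  qed (use Un Int in \<open>simp_all add: clopen_upsets_intros\<close>)
  with assms(1) show ?thesis by blast
qed

end

section \<open>Prime filters\<close>

lemma open_coord: "open {\<theta> :: 'k \<Rightarrow> bool. \<theta> a}"
  and closed_coord: "closed {\<theta> :: 'k \<Rightarrow> bool. \<theta> a}"
proof -
  have *: "continuous_on UNIV (\<lambda>\<theta> :: 'k \<Rightarrow> bool. \<theta> a)"
    by (rule continuous_on_product_coordinates)
  have "{\<theta> :: 'k \<Rightarrow> bool. \<theta> a} = (\<lambda>\<theta>. \<theta> a) -` {True}" by auto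
  then show "open {\<theta> :: 'k \<Rightarrow> bool. \<theta> a}" "closed {\<theta> :: 'k \<Rightarrow> bool. \<theta> a}"
    using open_vimage[OF open_discrete[of "{True}"] *] closed_vimage[OF _ *, of "{True}"] by auto
qed

lemma open_ncoord: "open {\<theta> :: 'k \<Rightarrow> bool. \<not> \<theta> a}"
  and closed_ncoord: "closed {\<theta> :: 'k \<Rightarrow> bool. \<not> \<theta> a}"
  by (intro open_Collect_neg closed_Collect_neg open_coord closed_coord)+

lemma compact_UNIV_bool_fun: "compact (UNIV :: ('k \<Rightarrow> bool) set)"
proof -
  have "compact_space (product_topology (\<lambda>_ :: 'k. euclidean :: bool topology) UNIV)"
    unfolding compact_space_product_topology
    by (auto simp: compact_space_def compactin_euclidean_iff intro: finite_imp_compact)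
  then show ?thesis
    by (simp add: euclidean_product_topology compact_space_def compactin_euclidean_iff)
qed

text \<open>Both the prime filters of an algebra and the points of the tensor product arise from closed
  subsets of a Cantor cube.\<close>

lemma compactin_cantor_image:
  fixes S :: "('k \<Rightarrow> bool) set"
  assumes "closed S"
    and op: "\<And>U. U \<in> \<B> \<Longrightarrow> \<exists>V. open V \<and> (\<forall>\<theta>\<in>S. g \<theta> \<in> U \<longleftrightarrow> \<theta> \<in> V)"
    and "g ` S \<subseteq> \<Union>\<B>"
  shows "compactin (topology_generated_by \<B>) (g ` S)"
proof (rule image_compactin)
  have "compact S"
    using compact_Int_closed[OF compact_UNIV_bool_fun \<open>closed S\<close>] by simp
  then show "compactin (top_of_set S) S"
    by (simp add: compactin_subtopology compactin_euclidean_iff)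
  show "continuous_map (top_of_set S) (topology_generated_by \<B>) g"
  proof (rule continuous_on_generated_topo)
    show "openin (top_of_set S) (g -` U \<inter> topspace (top_of_set S))" if U: "U \<in> \<B>" for U
    proof -
      obtain V where "open V" "\<forall>\<theta>\<in>S. g \<theta> \<in> U \<longleftrightarrow> \<theta> \<in> V"
        using op[OF U] by blast
      then have "g -` U \<inter> topspace (top_of_set S) = S \<inter> V" by auto
      then show ?thesis
        using \<open>open V\<close> by (simp add: openin_open_Int)
    qed
  qed (use assms(3) in auto)
qed

section \<open>Prime filters of Heyting algebras: separation and implication\<close>

context heyting_algebra
begin

lemma meet_mono:
  assumes "a \<sqsubseteq> a'" "b \<sqsubseteq> b'" "a \<in> carrier L" "b \<in> carrier L" "a' \<in> carrier L" "b' \<in> carrier L"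
  shows "a \<sqinter> b \<sqsubseteq> a' \<sqinter> b'"
  using assms by (meson le_trans meet_closed meet_le meet_left meet_right)

lemma meet_idem: "x \<in> carrier L \<Longrightarrow> x \<sqinter> x = x"
  by (rule meet_equality(2)) auto

lemma join_idem: "x \<in> carrier L \<Longrightarrow> x \<squnion> x = x"
  by (rule join_equality(2)) auto

lemma meet_interchange:
  assumes "a \<in> carrier L" "b \<in> carrier L" "c \<in> carrier L" "d \<in> carrier L"
  shows "(a \<sqinter> b) \<sqinter> (c \<sqinter> d) = (a \<sqinter> c) \<sqinter> (b \<sqinter> d)"
proof (rule meet_equality(2))
  show "(a \<sqinter> c) \<sqinter> (b \<sqinter> d) \<sqsubseteq> a \<sqinter> b" "(a \<sqinter> c) \<sqinter> (b \<sqinter> d) \<sqsubseteq> c \<sqinter> d"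
    using assms by (auto intro!: meet_mono meet_left meet_right)
  show "w \<sqsubseteq> (a \<sqinter> c) \<sqinter> (b \<sqinter> d)" if "w \<in> carrier L" "w \<sqsubseteq> a \<sqinter> b" "w \<sqsubseteq> c \<sqinter> d" for w
  proof -
    have "w \<sqsubseteq> a" "w \<sqsubseteq> b" "w \<sqsubseteq> c" "w \<sqsubseteq> d"
      using that assms by (meson le_trans meet_closed meet_left meet_right)+
    then show ?thesis
      using that(1) assms by (simp add: meet_le)
  qed
qed (use assms in auto)

text \<open>Conditions that mirror the lattice operations pull back along homomorphisms, and each of
  them involves only finitely many coordinates of an indicator function, which is what the
  compactness argument needs.\<close>

lemma prime_filters_iff:
  "P \<in> prime_filters L \<longleftrightarrow> P \<subseteq> carrier L \<and> \<top> \<in> P \<and> \<bottom> \<notin> P \<and>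
    (\<forall>x\<in>carrier L. \<forall>y\<in>carrier L. x \<sqinter> y \<in> P \<longleftrightarrow> x \<in> P \<and> y \<in> P) \<and>
    (\<forall>x\<in>carrier L. \<forall>y\<in>carrier L. x \<squnion> y \<in> P \<longleftrightarrow> x \<in> P \<or> y \<in> P)" (is "?l \<longleftrightarrow> ?r")
proof
  assume ?l
  then have P: "P \<subseteq> carrier L" "P \<noteq> {}" "P \<noteq> carrier L"
    and up: "\<And>x y. x \<in> P \<Longrightarrow> y \<in> carrier L \<Longrightarrow> x \<sqsubseteq> y \<Longrightarrow> y \<in> P"
    and meet: "\<And>x y. x \<in> P \<Longrightarrow> y \<in> P \<Longrightarrow> x \<sqinter> y \<in> P"
    and join: "\<And>x y. x \<in> carrier L \<Longrightarrow> y \<in> carrier L \<Longrightarrow> x \<squnion> y \<in> P \<Longrightarrow> x \<in> P \<or> y \<in> P"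
    by (auto simp: prime_filters_def is_upset_def)
  have "\<top> \<in> P"
    using P(1,2) up top_closed top_higher by blast
  moreover have "\<bottom> \<notin> P"
    using P(1,3) up bottom_lower by blast
  ultimately show ?r
    using P(1) up meet join
    by (metis join_closed join_left join_right meet_closed meet_left meet_right)
next
  assume r: ?r
  have up: "y \<in> P" if "x \<in> P" "y \<in> carrier L" "x \<sqsubseteq> y" for x y
  proof -
    have "x \<in> carrier L"
      using r that by blast
    then have "x \<sqinter> y = x"
      using that by (intro meet_equality(2)) auto
    with r that \<open>x \<in> carrier L\<close> show ?thesis by metis
  qed
  have r': "P \<subseteq> carrier L" "\<top> \<in> P" "\<bottom> \<notin> P"
    "\<And>x y. x \<in> carrier L \<Longrightarrow> y \<in> carrier L \<Longrightarrow> x \<sqinter> y \<in> P \<longleftrightarrow> x \<in> P \<and> y \<in> P"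
    "\<And>x y. x \<in> carrier L \<Longrightarrow> y \<in> carrier L \<Longrightarrow> x \<squnion> y \<in> P \<longleftrightarrow> x \<in> P \<or> y \<in> P"
    using r by auto
  show ?l
    unfolding prime_filters_def is_upset_def mem_Collect_eq
  proof (intro conjI ballI impI)
    show "P \<noteq> {}"
      using r'(2) by auto
    show "P \<noteq> carrier L"
      using r'(3) bottom_closed by metis
    show "x \<sqinter> y \<in> P" if "x \<in> P" "y \<in> P" for x y
      using r'(4)[OF subsetD[OF r'(1) that(1)] subsetD[OF r'(1) that(2)]] that by simp
    show "y \<in> P" if "x \<in> P" "y \<in> carrier L" "x \<sqsubseteq> y" for x y
      using that by (rule up)
    show "x \<in> P \<or> y \<in> P" if "x \<in> carrier L" "y \<in> carrier L" "x \<squnion> y \<in> P" for x y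
      using r'(5)[OF that(1,2)] that(3) by simp
  qed (rule r'(1))
qed

lemma prime_filter_mono:
  assumes "P \<in> prime_filters L" "x \<in> P" "x \<sqsubseteq> y" "y \<in> carrier L"
  shows "y \<in> P"
  using assms by (auto simp: prime_filters_def is_upset_def)

text \<open>Zorn's lemma yields a filter that is maximal among those containing \<open>A\<close> and
  missing \<open>B\<close>, and maximality makes it prime. Asking for closure under meets and joins
  rather than for a filter and an ideal allows images under homomorphisms to be plugged in
  directly.\<close>

theorem prime_filter_separation:
  assumes A: "A \<subseteq> carrier L" "A \<noteq> {}" "\<And>x y. x \<in> A \<Longrightarrow> y \<in> A \<Longrightarrow> x \<sqinter> y \<in> A"
    and B: "B \<subseteq> carrier L" "B \<noteq> {}" "\<And>x y. x \<in> B \<Longrightarrow> y \<in> B \<Longrightarrow> x \<squnion> y \<in> B"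
    and AB: "\<And>a b. a \<in> A \<Longrightarrow> b \<in> B \<Longrightarrow> \<not> a \<sqsubseteq> b"
  obtains P where "P \<in> prime_filters L" "A \<subseteq> P" "P \<inter> B = {}"
proof -
  define is_filter where "is_filter = (\<lambda>F. is_upset (le L) (carrier L) F \<and> A \<subseteq> F \<and>
    (\<forall>x\<in>F. \<forall>y\<in>F. x \<sqinter> y \<in> F) \<and> F \<inter> B = {})"
  define gen where "gen = (\<lambda>F. {z \<in> carrier L. \<exists>p\<in>F. p \<sqsubseteq> z})"
  have gen_filter: "is_filter (gen F)"
    if "F \<subseteq> carrier L" "A \<subseteq> gen F" "\<And>x y. x \<in> F \<Longrightarrow> y \<in> F \<Longrightarrow> x \<sqinter> y \<in> F"
      "\<And>a b. a \<in> F \<Longrightarrow> b \<in> B \<Longrightarrow> \<not> a \<sqsubseteq> b" for F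
    unfolding is_filter_def
  proof (intro conjI ballI)
    show "is_upset (le L) (carrier L) (gen F)"
      unfolding is_upset_def gen_def
    proof (intro conjI ballI impI)
      fix x y assume "x \<in> {z \<in> carrier L. \<exists>p\<in>F. p \<sqsubseteq> z}" "y \<in> carrier L" "x \<sqsubseteq> y"
      then show "y \<in> {z \<in> carrier L. \<exists>p\<in>F. p \<sqsubseteq> z}"
        using that(1) le_trans by blast
    qed auto
    show "A \<subseteq> gen F" by fact
    show "gen F \<inter> B = {}"
      using that(4) by (auto simp: gen_def)
    fix x y assume "x \<in> gen F" "y \<in> gen F"
    then obtain p q where pq: "p \<in> F" "q \<in> F" "p \<sqsubseteq> x" "q \<sqsubseteq> y" and xy: "x \<in> carrier L" "y \<in> carrier L"
      by (auto simp: gen_def)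
    then have "p \<sqinter> q \<sqsubseteq> x \<sqinter> y"
      using that(1) by (intro meet_mono) auto
    then show "x \<sqinter> y \<in> gen F"
      using that(3)[OF pq(1,2)] xy by (auto simp: gen_def)
  qed
  have "\<exists>M\<in>Collect is_filter. \<forall>X\<in>Collect is_filter. M \<subseteq> X \<longrightarrow> X = M"
  proof (rule subset_Zorn_nonempty)
    have "A \<subseteq> gen A"
      using A(1) le_refl unfolding gen_def by blast
    then have "is_filter (gen A)"
      using A(1,3) AB by (intro gen_filter)
    then show "Collect is_filter \<noteq> {}" by blast
    fix \<C> assume \<C>: "\<C> \<noteq> {}" "subset.chain (Collect is_filter) \<C>"
    then have fil: "\<And>F. F \<in> \<C> \<Longrightarrow> is_filter F"
      and ch: "\<And>F F'. F \<in> \<C> \<Longrightarrow> F' \<in> \<C> \<Longrightarrow> F \<subseteq> F' \<or> F' \<subseteq> F"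
      by (auto simp: subset_chain_def)
    have "x \<sqinter> y \<in> \<Union>\<C>" if xy: "x \<in> \<Union>\<C>" "y \<in> \<Union>\<C>" for x y
    proof -
      obtain F F' where F: "F \<in> \<C>" "F' \<in> \<C>" "x \<in> F" "y \<in> F'"
        using xy by blast
      then obtain F'' where F'': "F'' \<in> \<C>" "x \<in> F''" "y \<in> F''"
        using ch[of F F'] by blast
      with fil show ?thesis
        unfolding is_filter_def by blast
    qed
    moreover have "is_upset (le L) (carrier L) (\<Union>\<C>)"
      using fil unfolding is_filter_def is_upset_def by blast
    moreover have "A \<subseteq> \<Union>\<C>" "\<Union>\<C> \<inter> B = {}"
      using fil \<C>(1) unfolding is_filter_def by blast+
    ultimately show "\<Union>\<C> \<in> Collect is_filter"
      by (simp add: is_filter_def)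
  qed
  then obtain P where P: "is_filter P" and max: "\<And>F. is_filter F \<Longrightarrow> P \<subseteq> F \<Longrightarrow> F = P" by blast
  have Pc: "P \<subseteq> carrier L" and AP: "A \<subseteq> P" and PB: "P \<inter> B = {}"
    and meet: "\<And>x y. x \<in> P \<Longrightarrow> y \<in> P \<Longrightarrow> x \<sqinter> y \<in> P"
    and up: "\<And>x y. x \<in> P \<Longrightarrow> y \<in> carrier L \<Longrightarrow> x \<sqsubseteq> y \<Longrightarrow> y \<in> P"
    using P by (auto simp: is_filter_def is_upset_def)
  \<comment> \<open>Maximality in usable form: adjoining \<open>x\<close> to \<open>P\<close> must
    produce an element below some member of \<open>B\<close>.\<close>
  have hits: "\<exists>p\<in>P. \<exists>b\<in>B. p \<sqinter> x \<sqsubseteq> b" if x: "x \<in> carrier L" "x \<notin> P" for x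
  proof (rule ccontr)
    assume no: "\<not> ?thesis"
    let ?F = "(\<lambda>p. p \<sqinter> x) ` P"
    have "P \<subseteq> gen ?F"
      using Pc x(1) meet_left unfolding gen_def by blast
    moreover have "is_filter (gen ?F)"
    proof (rule gen_filter)
      show "?F \<subseteq> carrier L"
        using Pc x(1) by auto
      show "A \<subseteq> gen ?F"
        using AP \<open>P \<subseteq> gen ?F\<close> by blast
      show "u \<sqinter> v \<in> ?F" if uv: "u \<in> ?F" "v \<in> ?F" for u v
      proof -
        obtain p q where pq: "p \<in> P" "q \<in> P" "u = p \<sqinter> x" "v = q \<sqinter> x"
          using uv by blast
        then have c: "p \<in> carrier L" "q \<in> carrier L"
          using Pc by auto
        have "u \<sqinter> v = (p \<sqinter> q) \<sqinter> x"
          using meet_interchange[OF c(1) x(1) c(2) x(1)] meet_idem[OF x(1)] pq by simp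
        with pq meet show ?thesis by blast
      qed
      show "\<not> a \<sqsubseteq> b" if "a \<in> ?F" "b \<in> B" for a b
        using no that by blast
    qed
    ultimately have "gen ?F = P"
      using max by blast
    moreover obtain p where "p \<in> P"
      using AP A(2) by blast
    then have "x \<in> gen ?F"
      using x(1) Pc meet_right unfolding gen_def by blast
    ultimately show False
      using x(2) by blast
  qed
  have prime: "x \<in> P \<or> y \<in> P" if xy: "x \<in> carrier L" "y \<in> carrier L" "x \<squnion> y \<in> P" for x y
  proof (rule ccontr)
    assume "\<not> ?thesis"
    then obtain p q b c where *: "p \<in> P" "b \<in> B" "p \<sqinter> x \<sqsubseteq> b" "q \<in> P" "c \<in> B" "q \<sqinter> y \<sqsubseteq> c"
      using hits xy by meson
    then have cl: "p \<in> carrier L" "b \<in> carrier L" "q \<in> carrier L" "c \<in> carrier L"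
      using Pc B(1) by auto
    let ?r = "p \<sqinter> q" and ?k = "b \<squnion> c"
    have "x \<sqinter> ?r \<sqsubseteq> ?k"
    proof -
      have "x \<sqinter> ?r \<sqsubseteq> x \<sqinter> p"
        using cl xy by (intro meet_mono meet_left) auto
      also have "x \<sqinter> p = p \<sqinter> x"
        by (rule meet_comm)
      also have "p \<sqinter> x \<sqsubseteq> b" by fact
      also have "b \<sqsubseteq> ?k"
        using cl by (intro join_left)
      finally show ?thesis
        using cl xy by simp
    qed
    moreover have "y \<sqinter> ?r \<sqsubseteq> ?k"
    proof -
      have "y \<sqinter> ?r \<sqsubseteq> y \<sqinter> q"
        using cl xy by (intro meet_mono meet_right) auto
      also have "y \<sqinter> q = q \<sqinter> y"
        by (rule meet_comm)
      also have "q \<sqinter> y \<sqsubseteq> c" by fact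
      also have "c \<sqsubseteq> ?k"
        using cl by (intro join_right)
      finally show ?thesis
        using cl xy by simp
    qed
    \<comment> \<open>Distributivity enters through residuation: \<open>x\<close> and
      \<open>y\<close> both lie below \<open>?r \<Rrightarrow> ?k\<close>, hence so does their
      join.\<close>
    ultimately have "x \<sqsubseteq> ?r \<Rrightarrow> ?k" "y \<sqsubseteq> ?r \<Rrightarrow> ?k"
      using residuation cl xy by simp_all
    then have "x \<squnion> y \<sqsubseteq> ?r \<Rrightarrow> ?k"
      using cl xy by (intro join_le) (auto simp: imp_closed)
    then have "(x \<squnion> y) \<sqinter> ?r \<sqsubseteq> ?k"
      using residuation cl xy by simp
    moreover have "(x \<squnion> y) \<sqinter> ?r \<in> P"
      using meet * xy(3) by blast
    ultimately have "?k \<in> P"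
      using up cl by simp
    moreover have "?k \<in> B"
      using B(3) * by blast
    ultimately show False
      using PB by blast
  qed
  have "P \<noteq> {}" "P \<noteq> carrier L"
    using AP A(2) PB B(1,2) by blast+
  then have "P \<in> prime_filters L"
    using Pc meet up prime unfolding prime_filters_def is_upset_def by blast
  then show thesis
    using that AP PB by blast
qed

lemma le_iff_prime_filters:
  assumes "x \<in> carrier L" "y \<in> carrier L"
  shows "x \<sqsubseteq> y \<longleftrightarrow> (\<forall>P\<in>prime_filters L. x \<in> P \<longrightarrow> y \<in> P)"
proof
  assume "x \<sqsubseteq> y"
  then show "\<forall>P\<in>prime_filters L. x \<in> P \<longrightarrow> y \<in> P"
    using prime_filter_mono assms by blast
next
  assume *: "\<forall>P\<in>prime_filters L. x \<in> P \<longrightarrow> y \<in> P"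
  show "x \<sqsubseteq> y"
  proof (rule ccontr)
    assume "\<not> x \<sqsubseteq> y"
    then obtain P where "P \<in> prime_filters L" "{x} \<subseteq> P" "P \<inter> {y} = {}"
      using assms by (auto intro: prime_filter_separation[of "{x}" "{y}"] simp: meet_idem join_idem)
    with * show False by blast
  qed
qed

text \<open>If \<open>x \<Rrightarrow> y\<close> is not in \<open>P\<close>, then by residuation no
  \<open>p \<sqinter> x\<close> with \<open>p\<close> in \<open>P\<close> lies below
  \<open>y\<close>, and prime filter separation extends \<open>P\<close> by \<open>x\<close> while
  avoiding \<open>y\<close>. Later arguments about implications in \<open>G i\<close> and
  \<open>H\<close> rest on this criterion.\<close>

lemma imp_mem_prime_filter:
  assumes P: "P \<in> prime_filters L" and xy: "x \<in> carrier L" "y \<in> carrier L"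
  shows "x \<Rrightarrow> y \<in> P \<longleftrightarrow> (\<forall>Q\<in>prime_filters L. P \<subseteq> Q \<longrightarrow> x \<in> Q \<longrightarrow> y \<in> Q)"
proof
  assume imp: "x \<Rrightarrow> y \<in> P"
  show "\<forall>Q\<in>prime_filters L. P \<subseteq> Q \<longrightarrow> x \<in> Q \<longrightarrow> y \<in> Q"
  proof (intro ballI impI)
    fix Q assume Q: "Q \<in> prime_filters L" "P \<subseteq> Q" "x \<in> Q"
    then have "(x \<Rrightarrow> y) \<sqinter> x \<in> Q"
      using imp xy imp_closed[OF xy] by (auto simp: prime_filters_iff)
    moreover have "(x \<Rrightarrow> y) \<sqinter> x \<sqsubseteq> y"
      using residuation[of x y "x \<Rrightarrow> y"] xy imp_closed[OF xy] by simp
    ultimately show "y \<in> Q"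
      using prime_filter_mono Q(1) xy by blast
  qed
next
  assume *: "\<forall>Q\<in>prime_filters L. P \<subseteq> Q \<longrightarrow> x \<in> Q \<longrightarrow> y \<in> Q"
  have Pc: "P \<subseteq> carrier L" and top: "\<top> \<in> P"
    and meet: "\<And>u v. u \<in> P \<Longrightarrow> v \<in> P \<Longrightarrow> u \<sqinter> v \<in> P"
    using P by (simp_all add: prime_filters_iff subset_iff)
  show "x \<Rrightarrow> y \<in> P"
  proof (rule ccontr)
    assume no: "x \<Rrightarrow> y \<notin> P"
    let ?A = "(\<lambda>p. p \<sqinter> x) ` P"
    obtain Q where Q: "Q \<in> prime_filters L" "?A \<subseteq> Q" "Q \<inter> {y} = {}"
    proof (rule prime_filter_separation[of ?A "{y}"])
      show "u \<sqinter> v \<in> ?A" if uv: "u \<in> ?A" "v \<in> ?A" for u v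
      proof -
        obtain p q where pq: "p \<in> P" "q \<in> P" "u = p \<sqinter> x" "v = q \<sqinter> x"
          using uv by blast
        then have c: "p \<in> carrier L" "q \<in> carrier L"
          using Pc by auto
        have "u \<sqinter> v = (p \<sqinter> q) \<sqinter> x"
          using meet_interchange[OF c(1) xy(1) c(2) xy(1)] meet_idem[OF xy(1)] pq by simp
        with pq meet show ?thesis by blast
      qed
      show "u \<squnion> v \<in> {y}" if "u \<in> {y}" "v \<in> {y}" for u v
        using that xy by (simp add: join_idem)
      show "\<not> a \<sqsubseteq> b" if ab: "a \<in> ?A" "b \<in> {y}" for a b
      proof
        assume "a \<sqsubseteq> b"
        with ab obtain p where p: "p \<in> P" "p \<sqinter> x \<sqsubseteq> y" by blast
        then have "p \<sqsubseteq> x \<Rrightarrow> y"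
          using residuation[OF xy] Pc by blast
        with p(1) no show False
          using prime_filter_mono[OF P] imp_closed[OF xy] by blast
      qed
    qed (use Pc top xy in auto)
    have "p \<in> Q \<and> x \<in> Q" if "p \<in> P" for p
    proof -
      have "p \<sqinter> x \<in> Q" "p \<in> carrier L"
        using Q(2) that Pc by auto
      with Q(1) xy(1) show ?thesis
        by (simp add: prime_filters_iff)
    qed
    with top have "P \<subseteq> Q" "x \<in> Q" by auto
    with * Q(1) have "y \<in> Q" by blast
    with Q(3) show False by blast
  qed
qed

section \<open>The dual Priestley space\<close>

lemma points_dual: "points (dual_space L) = prime_filters L"
  using top_closed by (intro points_dual_space) auto

lemma ole_dual: "ole (dual_space L) P Q \<longleftrightarrow> P \<subseteq> Q"
  by (simp add: dual_space_def)

lemma stone_map_clopen_upset: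
  assumes "a \<in> carrier L"
  shows "stone_map L a \<in> clopen_upsets (dual_space L)"
proof -
  have "openin (otop (dual_space L)) (stone_map L a)"
    "openin (otop (dual_space L)) (prime_filters L - stone_map L a)"
    unfolding dual_space_def ospace.simps using assms by (intro topology_generated_by_Basis; blast)+
  then show ?thesis
    by (auto simp: clopen_upsets_def clopens_def closedin_def is_upset_def points_dual stone_map_def ole_dual)
qed

lemma compact_dual: "compact_space (otop (dual_space L))"
proof -
  \<comment> \<open>Indicator functions of prime filters. The equivalences are split into
    implications between coordinates so that closedness follows connective by connective; the
    support condition keeps the coded set inside the carrier.\<close>
  let ?S = "{\<theta>. \<theta> \<top> \<and> \<not> \<theta> \<bottom> \<and> (\<forall>x. \<theta> x \<longrightarrow> x \<in> carrier L) \<and>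
    (\<forall>x y. x \<in> carrier L \<and> y \<in> carrier L \<longrightarrow>
      (\<theta> (x \<sqinter> y) \<longrightarrow> \<theta> x \<and> \<theta> y) \<and> (\<theta> x \<and> \<theta> y \<longrightarrow> \<theta> (x \<sqinter> y)) \<and>
      (\<theta> (x \<squnion> y) \<longrightarrow> \<theta> x \<or> \<theta> y) \<and> (\<theta> x \<or> \<theta> y \<longrightarrow> \<theta> (x \<squnion> y)))}"
  have S: "Collect ` ?S = prime_filters L"
  proof (rule Set.set_eqI)
    fix P :: "'a set"
    have "P \<in> Collect ` S \<longleftrightarrow> (\<lambda>x. x \<in> P) \<in> S" for S
      by (auto simp: image_iff intro: bexI[of _ "\<lambda>x. x \<in> P"])
    then have "P \<in> Collect ` ?S \<longleftrightarrow> (\<lambda>x. x \<in> P) \<in> ?S" .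
    also have "\<dots> \<longleftrightarrow> P \<in> prime_filters L"
      unfolding prime_filters_iff by blast
    finally show "P \<in> Collect ` ?S \<longleftrightarrow> P \<in> prime_filters L" .
  qed
  have "closed ?S"
    by (intro closed_Collect_conj closed_Collect_all closed_Collect_imp closed_Collect_disj
      open_Collect_conj open_Collect_disj closed_coord closed_ncoord open_coord
      closed_Collect_const open_Collect_const)
  then have "compactin (otop (dual_space L)) (Collect ` ?S)"
    unfolding dual_space_def ospace.simps
  proof (rule compactin_cantor_image)
    fix U assume "U \<in> stone_map L ` carrier L \<union> (\<lambda>a. prime_filters L - stone_map L a) ` carrier L"
    then consider a where "U = stone_map L a" | a where "U = prime_filters L - stone_map L a"
      by blast
    moreover have *: "Collect \<theta> \<in> stone_map L a \<longleftrightarrow> \<theta> a" if "\<theta> \<in> ?S" for \<theta> a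
      using S imageI[OF that, of Collect] unfolding stone_map_def by blast
    moreover have **: "Collect \<theta> \<in> prime_filters L" if "\<theta> \<in> ?S" for \<theta>
      using S imageI[OF that, of Collect] by blast
    ultimately show "\<exists>V. open V \<and> (\<forall>\<theta>\<in>?S. Collect \<theta> \<in> U \<longleftrightarrow> \<theta> \<in> V)"
    proof cases
      case (1 a)
      have "\<forall>\<theta>\<in>?S. Collect \<theta> \<in> U \<longleftrightarrow> \<theta> \<in> {\<theta>. \<theta> a}"
        unfolding 1 Diff_iff mem_Collect_eq[of _ "\<lambda>\<theta>. \<theta> a"] using * ** by blast
      then show ?thesis
        by (intro exI[of _ "{\<theta>. \<theta> a}"] conjI open_coord)
    next
      case (2 a)
      have "\<forall>\<theta>\<in>?S. Collect \<theta> \<in> U \<longleftrightarrow> \<theta> \<in> {\<theta>. \<not> \<theta> a}"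
        unfolding 2 Diff_iff mem_Collect_eq[of _ "\<lambda>\<theta>. \<not> \<theta> a"] using * ** by blast
      then show ?thesis
        by (intro exI[of _ "{\<theta>. \<not> \<theta> a}"] conjI open_ncoord)
    qed
  next
    show "Collect ` ?S \<subseteq> \<Union> (stone_map L ` carrier L \<union> (\<lambda>a. prime_filters L - stone_map L a) ` carrier L)"
    proof -
      have "prime_filters L = stone_map L \<top> \<union> (prime_filters L - stone_map L \<top>)"
        by (auto simp: stone_map_def)
      then show ?thesis
        unfolding S using top_closed by blast
    qed
  qed
  then show ?thesis
    unfolding S compact_space_def points_dual .
qed

lemma priestley_dual: "priestley_space (dual_space L)"
proof
  show "\<exists>U\<in>clopen_upsets (dual_space L). P \<in> U \<and> Q \<notin> U"
    if PQ: "P \<in> points (dual_space L)" "Q \<in> points (dual_space L)" "\<not> ole (dual_space L) P Q" for P Q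
  proof -
    obtain a where "a \<in> P" "a \<notin> Q"
      using PQ by (auto simp: ole_dual)
    moreover have "a \<in> carrier L"
      using \<open>a \<in> P\<close> PQ(1) by (auto simp: points_dual prime_filters_iff)
    ultimately show ?thesis
      using stone_map_clopen_upset[of a] PQ(1)
      by (intro bexI[of _ "stone_map L a"]) (auto simp: stone_map_def points_dual)
  qed
qed (use compact_dual in \<open>auto simp: ole_dual\<close>)

end

text \<open>Prelinearity puts \<open>x \<Rrightarrow> y\<close> or \<open>y \<Rrightarrow> x\<close>
  into \<open>P\<close>, which excludes a pair with \<open>x\<close> in \<open>Q - R\<close> and
  \<open>y\<close> in \<open>R - Q\<close>. Applied to a test algebra, this makes the values of
  \<open>\<phi>\<close> chains.\<close>

lemma (in godel_algebra) prime_filters_root: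
  assumes P: "P \<in> prime_filters L" "Q \<in> prime_filters L" "R \<in> prime_filters L" "P \<subseteq> Q" "P \<subseteq> R"
  shows "Q \<subseteq> R \<or> R \<subseteq> Q"
proof (rule ccontr)
  assume "\<not> ?thesis"
  then obtain x y where xy: "x \<in> Q" "x \<notin> R" "y \<in> R" "y \<notin> Q" by blast
  then have c: "x \<in> carrier L" "y \<in> carrier L"
    using P by (auto simp: prime_filters_iff)
  have "(x \<Rrightarrow> y) \<squnion> (y \<Rrightarrow> x) \<in> P"
    using prelinearity[OF c] P(1) by (simp add: prime_filters_iff)
  then have "x \<Rrightarrow> y \<in> P \<or> y \<Rrightarrow> x \<in> P"
    using P(1) imp_closed c by (simp add: prime_filters_iff)
  then show False
    using imp_mem_prime_filter P c xy by blast
qed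

section \<open>Products\<close>

lemma points_prod: "points (prod_ospace I Y) = (\<Pi>\<^sub>E i\<in>I. points (Y i))"
  by (simp add: prod_ospace_def)

lemma ole_prod: "ole (prod_ospace I Y) x y \<longleftrightarrow> (\<forall>i\<in>I. ole (Y i) (x i) (y i))"
  by (simp add: prod_ospace_def)

lemma cylinder_clopen_upset:
  assumes "i \<in> I" "U \<in> clopen_upsets (Y i)"
  shows "{x \<in> points (prod_ospace I Y). x i \<in> U} \<in> clopen_upsets (prod_ospace I Y)"
proof -
  have "continuous_map (otop (prod_ospace I Y)) (otop (Y i)) (\<lambda>x. x i)"
    using continuous_map_product_projection[OF assms(1), of "\<lambda>i. otop (Y i)"] by (simp add: prod_ospace_def)
  then have "{x \<in> points (prod_ospace I Y). x i \<in> U} \<in> clopens (prod_ospace I Y)"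
    using assms(2) unfolding clopen_upsets_def clopens_def mem_Collect_eq
    by (intro conjI openin_continuous_map_preimage[of _ "otop (Y i)"]
      closedin_continuous_map_preimage[of _ "otop (Y i)"]) auto
  moreover have "is_upset (ole (prod_ospace I Y)) (points (prod_ospace I Y))
      {x \<in> points (prod_ospace I Y). x i \<in> U}"
    unfolding is_upset_def
  proof (intro conjI ballI impI)
    fix x y assume xy: "x \<in> {x \<in> points (prod_ospace I Y). x i \<in> U}" "y \<in> points (prod_ospace I Y)"
      "ole (prod_ospace I Y) x y"
    then have "y i \<in> points (Y i)" "ole (Y i) (x i) (y i)" "x i \<in> U"
      using assms(1) by (auto simp: points_prod ole_prod)
    then show "y \<in> {x \<in> points (prod_ospace I Y). x i \<in> U}"
      using clopen_upsetsD[OF assms(2)] xy(2) by blast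
  qed auto
  ultimately show ?thesis
    by (simp add: clopen_upsets_def)
qed

text \<open>Compactness is Tychonoff's theorem. A failure of the componentwise order happens in some
  coordinate, where a cylinder over a clopen upset separates.\<close>

lemma priestley_prod:
  assumes "\<And>i. i \<in> I \<Longrightarrow> priestley_space (Y i)"
  shows "priestley_space (prod_ospace I Y)"
proof
  show "compact_space (otop (prod_ospace I Y))"
    using assms priestley_space.compact by (auto simp: prod_ospace_def compact_space_product_topology)
  show "ole (prod_ospace I Y) x x" if "x \<in> points (prod_ospace I Y)" for x
    using that priestley_space.refl[OF assms] by (auto simp: ole_prod points_prod)
  show "ole (prod_ospace I Y) x z"
    if "ole (prod_ospace I Y) x y" "ole (prod_ospace I Y) y z" "x \<in> points (prod_ospace I Y)"
      "y \<in> points (prod_ospace I Y)" "z \<in> points (prod_ospace I Y)" for x y z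
    unfolding ole_prod
  proof
    fix i assume i: "i \<in> I"
    show "ole (Y i) (x i) (z i)"
    proof (rule priestley_space.trans[OF assms[OF i]])
      show "ole (Y i) (x i) (y i)" "ole (Y i) (y i) (z i)"
        using that i by (simp_all add: ole_prod)
      show "x i \<in> points (Y i)" "y i \<in> points (Y i)" "z i \<in> points (Y i)"
        using that i by (auto simp: points_prod)
    qed
  qed
  show "x = y"
    if "ole (prod_ospace I Y) x y" "ole (prod_ospace I Y) y x" "x \<in> points (prod_ospace I Y)"
      "y \<in> points (prod_ospace I Y)" for x y
    using that(3,4) unfolding points_prod
  proof (rule PiE_ext)
    fix i assume i: "i \<in> I"
    show "x i = y i"
    proof (rule priestley_space.antisym[OF assms[OF i]])
      show "ole (Y i) (x i) (y i)" "ole (Y i) (y i) (x i)"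
        using that i by (simp_all add: ole_prod)
      show "x i \<in> points (Y i)" "y i \<in> points (Y i)"
        using that i by (auto simp: points_prod)
    qed
  qed
  show "\<exists>U\<in>clopen_upsets (prod_ospace I Y). x \<in> U \<and> y \<notin> U"
    if xy: "x \<in> points (prod_ospace I Y)" "y \<in> points (prod_ospace I Y)" "\<not> ole (prod_ospace I Y) x y" for x y
  proof -
    obtain i where i: "i \<in> I" "\<not> ole (Y i) (x i) (y i)"
      using xy(3) by (auto simp: ole_prod)
    have "x i \<in> points (Y i)" "y i \<in> points (Y i)"
      using xy(1,2) i(1) by (auto simp: points_prod)
    then obtain U where "U \<in> clopen_upsets (Y i)" "x i \<in> U" "y i \<notin> U"
      using priestley_space.separation[OF assms[OF i(1)] _ _ i(2)] by blast
    then show ?thesis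
      using cylinder_clopen_upset[of i I U Y, OF i(1)] xy(1)
      by (intro bexI[of _ "{x \<in> points (prod_ospace I Y). x i \<in> U}"]) auto
  qed
qed

section \<open>The tensor product of dual spaces\<close>

locale godel_family =
  fixes I :: "'i set" and G :: "'i \<Rightarrow> 'a heyting"
  assumes godel: "i \<in> I \<Longrightarrow> godel_algebra (G i)"
begin

abbreviation X :: "('i \<Rightarrow> 'a set) ospace" where
  "X \<equiv> prod_ospace I (\<lambda>i. dual_space (G i))"

abbreviation Z :: "('i \<Rightarrow> 'a set) set ospace" where
  "Z \<equiv> tensor I (\<lambda>i. dual_space (G i))"

lemma heyting: "i \<in> I \<Longrightarrow> heyting_algebra (G i)"
  using godel by (rule godel_algebra.axioms(1))

lemma points_X: "points X = (\<Pi>\<^sub>E i\<in>I. prime_filters (G i))"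
  unfolding points_prod by (rule PiE_cong) (rule heyting_algebra.points_dual[OF heyting])

lemma points_X_D: "x \<in> points X \<Longrightarrow> i \<in> I \<Longrightarrow> x i \<in> prime_filters (G i)"
  by (auto simp: points_X)

lemma ole_X: "ole X x y \<longleftrightarrow> (\<forall>i\<in>I. x i \<subseteq> y i)"
  by (simp add: ole_prod dual_space_def)

sublocale X: priestley_space X
  by (intro priestley_prod heyting_algebra.priestley_dual heyting)

section \<open>Cylinders, points and compactness of the tensor product\<close>

definition cyl :: "'i \<Rightarrow> 'a \<Rightarrow> ('i \<Rightarrow> 'a set) set" where
  "cyl i a = {x \<in> points X. x i \<in> stone_map (G i) a}"

lemma cyl_clopen_upset: "i \<in> I \<Longrightarrow> a \<in> carrier (G i) \<Longrightarrow> cyl i a \<in> clopen_upsets X"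
  unfolding cyl_def
  by (intro cylinder_clopen_upset heyting_algebra.stone_map_clopen_upset heyting)

lemma mem_cyl: "i \<in> I \<Longrightarrow> x \<in> points X \<Longrightarrow> x \<in> cyl i a \<longleftrightarrow> a \<in> x i"
  by (auto simp: cyl_def stone_map_def points_X_D)

lemma cyl_subset: "cyl i a \<subseteq> points X"
  by (auto simp: cyl_def)

lemma cyl_bot: "i \<in> I \<Longrightarrow> cyl i \<bottom>\<^bsub>G i\<^esub> = {}"
  and cyl_top: "i \<in> I \<Longrightarrow> cyl i \<top>\<^bsub>G i\<^esub> = points X"
proof -
  assume i: "i \<in> I"
  have "\<bottom>\<^bsub>G i\<^esub> \<notin> x i" "\<top>\<^bsub>G i\<^esub> \<in> x i" if "x \<in> points X" for x
    using points_X_D[OF that i] by (simp_all add: heyting_algebra.prime_filters_iff[OF heyting[OF i]])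
  then show "cyl i \<bottom>\<^bsub>G i\<^esub> = {}" "cyl i \<top>\<^bsub>G i\<^esub> = points X"
    using mem_cyl[OF i] cyl_subset[of i] by fast+
qed

lemma cyl_meet:
    "i \<in> I \<Longrightarrow> a \<in> carrier (G i) \<Longrightarrow> b \<in> carrier (G i) \<Longrightarrow> cyl i (a \<sqinter>\<^bsub>G i\<^esub> b) = cyl i a \<inter> cyl i b"
  and cyl_join:
    "i \<in> I \<Longrightarrow> a \<in> carrier (G i) \<Longrightarrow> b \<in> carrier (G i) \<Longrightarrow> cyl i (a \<squnion>\<^bsub>G i\<^esub> b) = cyl i a \<union> cyl i b"
  by (auto simp: cyl_def stone_map_def heyting_algebra.prime_filters_iff[OF heyting])

lemma points_Z:
  "C \<in> points Z \<longleftrightarrow> C \<in> closed_chains X \<and>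
    (\<forall>i\<in>I. \<forall>x\<in>C. \<forall>P\<in>prime_filters (G i). x i \<subseteq> P \<longrightarrow> (\<exists>y\<in>C. y i = P))"
proof -
  have "is_upset (ole (dual_space (G i))) (points (dual_space (G i))) ((\<lambda>x. x i) ` C) \<longleftrightarrow>
      (\<forall>x\<in>C. \<forall>P\<in>prime_filters (G i). x i \<subseteq> P \<longrightarrow> (\<exists>y\<in>C. y i = P))"
    if "i \<in> I" "C \<in> closed_chains X" for i
  proof -
    have "C \<subseteq> points X"
      using that closedin_subset by (auto simp: closed_chains_def)
    then have "(\<lambda>x. x i) ` C \<subseteq> prime_filters (G i)"
      using points_X_D that(1) by blast
    then show ?thesis
      unfolding is_upset_def heyting_algebra.points_dual[OF heyting[OF that(1)]]
        heyting_algebra.ole_dual[OF heyting[OF that(1)]]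
      by (auto simp: image_iff Bex_def eq_commute)
  qed
  then show ?thesis
    unfolding points_tensor mem_Collect_eq by (intro conj_cong refl ball_cong)
qed

text \<open>Nonempty closed sets are coded by the proper filters of clopens that contain them. Being
  a chain means not meeting both \<open>V - W\<close> and \<open>W - V\<close>, and the upset
  condition on projections becomes an implication between two coordinates. The codes thus form a
  closed subset of a Cantor cube, of which \<open>points Z\<close> is a continuous image.\<close>

lemma compact_points_Z: "compactin (otop (CC X)) (points Z)"
proof -
  \<comment> \<open>Values of \<open>\<theta>\<close> off the clopens are unconstrained, and
    \<open>?g\<close> never reads them. The last clause encodes the upset condition: a chain that
    avoids \<open>cyl i a - cyl i b\<close> must lie in
    \<open>cyl i (a \<Rrightarrow> b)\<close>.\<close>
  let ?S = "{\<theta>. \<theta> (points X) \<and> \<not> \<theta> {} \<and>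
    (\<forall>V W. V \<in> clopens X \<and> W \<in> clopens X \<longrightarrow> \<theta> (V \<inter> W) \<longrightarrow> \<theta> V) \<and>
    (\<forall>V W. V \<in> clopens X \<and> W \<in> clopens X \<longrightarrow> \<theta> V \<and> \<theta> W \<longrightarrow> \<theta> (V \<inter> W)) \<and>
    (\<forall>V W. V \<in> clopen_upsets X \<and> W \<in> clopen_upsets X \<longrightarrow>
      \<theta> (points X - (V - W)) \<or> \<theta> (points X - (W - V))) \<and>
    (\<forall>i a b. i \<in> I \<and> a \<in> carrier (G i) \<and> b \<in> carrier (G i) \<longrightarrow>
      \<theta> (points X - (cyl i a - cyl i b)) \<longrightarrow> \<theta> (cyl i (a \<Rrightarrow>\<^bsub>G i\<^esub> b)))}"
  let ?g = "\<lambda>\<theta>. \<Inter> {V \<in> clopens X. \<theta> V}"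
  have diff: "points X - (V - W) \<in> clopens X" if "V \<in> clopen_upsets X" "W \<in> clopen_upsets X" for V W
    using that by (intro clopens_Diff clopens_points clopen_upsets_clopens)
  have S_D: "\<theta> (points X)" "\<not> \<theta> {}"
    "\<And>V W. V \<in> clopens X \<Longrightarrow> W \<in> clopens X \<Longrightarrow> \<theta> (V \<inter> W) \<Longrightarrow> \<theta> V"
    "\<And>V W. V \<in> clopens X \<Longrightarrow> W \<in> clopens X \<Longrightarrow> \<theta> V \<Longrightarrow> \<theta> W \<Longrightarrow> \<theta> (V \<inter> W)"
    "\<And>V W. V \<in> clopen_upsets X \<Longrightarrow> W \<in> clopen_upsets X \<Longrightarrow>
      \<theta> (points X - (V - W)) \<or> \<theta> (points X - (W - V))"
    "\<And>i a b. i \<in> I \<Longrightarrow> a \<in> carrier (G i) \<Longrightarrow> b \<in> carrier (G i) \<Longrightarrow>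
      \<theta> (points X - (cyl i a - cyl i b)) \<Longrightarrow> \<theta> (cyl i (a \<Rrightarrow>\<^bsub>G i\<^esub> b))"
    if "\<theta> \<in> ?S" for \<theta>
  proof -
    note * = that[unfolded mem_Collect_eq]
    show "\<theta> (points X)" using * by (elim conjE)
    show "\<not> \<theta> {}" using * by (elim conjE)
    show "\<theta> V" if "V \<in> clopens X" "W \<in> clopens X" "\<theta> (V \<inter> W)" for V W
      using *[THEN conjunct2, THEN conjunct2, THEN conjunct1] that by blast
    show "\<theta> (V \<inter> W)" if "V \<in> clopens X" "W \<in> clopens X" "\<theta> V" "\<theta> W" for V W
      using *[THEN conjunct2, THEN conjunct2, THEN conjunct2, THEN conjunct1] that by blast
    show "\<theta> (points X - (V - W)) \<or> \<theta> (points X - (W - V))"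
      if "V \<in> clopen_upsets X" "W \<in> clopen_upsets X" for V W
      using *[THEN conjunct2, THEN conjunct2, THEN conjunct2, THEN conjunct2, THEN conjunct1] that by blast
    show "\<theta> (cyl i (a \<Rrightarrow>\<^bsub>G i\<^esub> b))"
      if "i \<in> I" "a \<in> carrier (G i)" "b \<in> carrier (G i)" "\<theta> (points X - (cyl i a - cyl i b))" for i a b
      using *[THEN conjunct2, THEN conjunct2, THEN conjunct2, THEN conjunct2, THEN conjunct2] that by blast
  qed
  \<comment> \<open>The closed set \<open>?g \<theta>\<close> remembers \<open>\<theta>\<close>: by
    compactness, a clopen around the intersection of a down-directed family of clopens contains a
    member of the family, and the filter clauses do the rest.\<close>
  have sub: "?g \<theta> \<subseteq> V \<longleftrightarrow> \<theta> V" if \<theta>: "\<theta> \<in> ?S" and V: "V \<in> clopens X" for \<theta> V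
  proof
    assume gV: "?g \<theta> \<subseteq> V"
    note top = S_D(1)[OF \<theta>] and Int1 = S_D(3)[OF \<theta>] and Int2 = S_D(4)[OF \<theta>]
    define \<U> where "\<U> = {points X - W |W. W \<in> clopens X \<and> \<theta> W}"
    have "\<exists>U\<in>\<U>. points X - V \<subseteq> U"
    proof (rule compactin_directed[of "otop X" "points X - V" \<U>])
      show "compactin (otop X) (points X - V)"
        using V by (intro X.closedin_compactin) (auto simp: clopens_def)
      show "openin (otop X) U" if "U \<in> \<U>" for U
        using that by (auto simp: \<U>_def clopens_def)
      show "{} \<in> \<U>"
        using top clopens_points[of X] by (auto simp: \<U>_def)
      show "U \<union> U' \<in> \<U>" if UU: "U \<in> \<U>" "U' \<in> \<U>" for U U'
      proof -
        obtain W W' where W: "W \<in> clopens X" "W' \<in> clopens X" "\<theta> W" "\<theta> W'"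
          "U = points X - W" "U' = points X - W'"
          using UU by (auto simp: \<U>_def)
        then have "U \<union> U' = points X - (W \<inter> W')" by blast
        moreover have "\<theta> (W \<inter> W')" "W \<inter> W' \<in> clopens X"
          using W by (auto intro: Int2 clopens_Int)
        ultimately show ?thesis
          unfolding \<U>_def by blast
      qed
      show "points X - V \<subseteq> \<Union>\<U>"
      proof
        fix x assume x: "x \<in> points X - V"
        then obtain W where "W \<in> clopens X" "\<theta> W" "x \<notin> W"
          using gV by blast
        with x show "x \<in> \<Union>\<U>"
          unfolding \<U>_def by blast
      qed
    qed blast
    then obtain W where W: "W \<in> clopens X" "\<theta> W" "points X - V \<subseteq> points X - W"
      unfolding \<U>_def by blast
    then have "V \<inter> W = W"
      using clopens_subset[OF W(1)] by blast
    then show "\<theta> V"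
      using Int1[OF V W(1)] W(2) by simp
  qed (use V in blast)
  have gZ: "?g \<theta> \<in> points Z" if \<theta>: "\<theta> \<in> ?S" for \<theta>
  proof -
    have gX: "?g \<theta> \<subseteq> points X" and ne: "?g \<theta> \<noteq> {}"
      using sub[OF \<theta> clopens_points] sub[OF \<theta> empty_clopens] S_D(1,2)[OF \<theta>] by simp_all
    have cl: "closedin (otop X) (?g \<theta>)"
      using S_D(1)[OF \<theta>] clopens_points[of X] by (intro closedin_Inter) (auto simp: clopens_def)
    have ch: "ole X x y \<or> ole X y x" if xy: "x \<in> ?g \<theta>" "y \<in> ?g \<theta>" for x y
    proof (rule ccontr)
      assume no: "\<not> ?thesis"
      have xy': "x \<in> points X" "y \<in> points X"
        using subsetD[OF gX xy(1)] subsetD[OF gX xy(2)] by simp_all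
      obtain V where V: "V \<in> clopen_upsets X" "x \<in> V" "y \<notin> V"
        using X.separation[OF xy'] no by blast
      obtain W where W: "W \<in> clopen_upsets X" "y \<in> W" "x \<notin> W"
        using X.separation[OF xy'(2,1)] no by blast
      have "\<theta> (points X - (V - W)) \<or> \<theta> (points X - (W - V))"
        by (rule S_D(5)[OF \<theta> V(1) W(1)])
      then have "x \<in> points X - (V - W) \<or> y \<in> points X - (W - V)"
        using xy diff[OF V(1) W(1)] diff[OF W(1) V(1)] by blast
      with V W show False by blast
    qed
    have up: "\<exists>y\<in>?g \<theta>. y i = P"
      if i: "i \<in> I" and x: "x \<in> ?g \<theta>" and P: "P \<in> prime_filters (G i)" "x i \<subseteq> P" for i x P
    proof (rule ccontr)
      assume no: "\<not> ?thesis"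
      interpret Gi: heyting_algebra "G i" by (rule heyting[OF i])
      \<comment> \<open>The sets \<open>cyl i a - cyl i b\<close> with \<open>a\<close> in
        \<open>P\<close> and \<open>b\<close> outside \<open>P\<close> are preimages of basic
        neighbourhoods of \<open>P\<close>. If no point of the chain projects to \<open>P\<close>,
        their complements form a directed cover, so one pair \<open>a\<close>, \<open>b\<close>
        works for the whole chain. The last clause of \<open>?S\<close> then puts
        \<open>a \<Rrightarrow> b\<close> into \<open>x i\<close>, hence into \<open>P\<close>,
        which is absurd.\<close>
      define \<U> where "\<U> = {points X - (cyl i a - cyl i b) |a b.
        a \<in> carrier (G i) \<and> b \<in> carrier (G i) \<and> a \<in> P \<and> b \<notin> P}"
      have \<U>_I: "points X - (cyl i a - cyl i b) \<in> \<U>"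
        if "a \<in> P" "b \<notin> P" "a \<in> carrier (G i)" "b \<in> carrier (G i)" for a b
        using that by (auto simp: \<U>_def)
      have "\<exists>U\<in>\<U>. ?g \<theta> \<subseteq> U"
      proof (rule compactin_directed[of "otop X" "?g \<theta>" \<U>])
        show "compactin (otop X) (?g \<theta>)"
          by (rule X.closedin_compactin) (rule cl)
        show "openin (otop X) U" if "U \<in> \<U>" for U
        proof -
          obtain a b where "a \<in> carrier (G i)" "b \<in> carrier (G i)" "U = points X - (cyl i a - cyl i b)"
            using \<open>U \<in> \<U>\<close> by (auto simp: \<U>_def)
          then have "U \<in> clopens X"
            using diff cyl_clopen_upset[OF i] by simp
          then show ?thesis by (simp add: clopens_def)
        qed
        have "\<top>\<^bsub>G i\<^esub> \<in> P" "\<bottom>\<^bsub>G i\<^esub> \<notin> P" "{} = points X - (cyl i \<top>\<^bsub>G i\<^esub> - cyl i \<bottom>\<^bsub>G i\<^esub>)"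
          using P(1) by (simp_all add: Gi.prime_filters_iff cyl_bot[OF i] cyl_top[OF i])
        then show "{} \<in> \<U>"
          using \<U>_I[of "\<top>\<^bsub>G i\<^esub>" "\<bottom>\<^bsub>G i\<^esub>"] Gi.top_closed Gi.bottom_closed by metis
        show "U \<union> U' \<in> \<U>" if UU: "U \<in> \<U>" "U' \<in> \<U>" for U U'
        proof -
          obtain a b a' b' where ab: "a \<in> carrier (G i)" "b \<in> carrier (G i)" "a \<in> P" "b \<notin> P"
            "U = points X - (cyl i a - cyl i b)"
            "a' \<in> carrier (G i)" "b' \<in> carrier (G i)" "a' \<in> P" "b' \<notin> P"
            "U' = points X - (cyl i a' - cyl i b')"
            using UU by (auto simp: \<U>_def)
          let ?a = "a \<sqinter>\<^bsub>G i\<^esub> a'" and ?b = "b \<squnion>\<^bsub>G i\<^esub> b'"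
          have "U \<union> U' = points X - (cyl i ?a - cyl i ?b)"
            using ab by (auto simp: cyl_meet[OF i] cyl_join[OF i])
          moreover have "?a \<in> P" "?b \<notin> P"
            using P(1) ab by (simp_all add: Gi.prime_filters_iff)
          moreover have "?a \<in> carrier (G i)" "?b \<in> carrier (G i)"
            using ab by simp_all
          ultimately show ?thesis
            using \<U>_I[of ?a ?b] by simp
        qed
        show "?g \<theta> \<subseteq> \<Union>\<U>"
        proof
          fix y assume y: "y \<in> ?g \<theta>"
          then have yX: "y \<in> points X" and yi: "y i \<noteq> P"
            using gX no by blast+
          have c: "y i \<subseteq> carrier (G i)" "P \<subseteq> carrier (G i)"
            using points_X_D[OF yX i] P(1) by (simp_all add: Gi.prime_filters_iff)
          \<comment> \<open>\<open>y i\<close> and \<open>P\<close> may differ in either direction;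
            the other half of the pair is filled by bottom or top.\<close>
          consider a where "a \<in> P" "a \<notin> y i" | b where "b \<in> y i" "b \<notin> P"
            using yi by blast
          then show "y \<in> \<Union>\<U>"
          proof cases
            case (1 a)
            then have "y \<in> points X - (cyl i a - cyl i \<bottom>\<^bsub>G i\<^esub>)"
              using yX by (simp add: mem_cyl[OF i])
            moreover have "\<bottom>\<^bsub>G i\<^esub> \<notin> P"
              using P(1) by (simp add: Gi.prime_filters_iff)
            ultimately show ?thesis
              using \<U>_I[of a "\<bottom>\<^bsub>G i\<^esub>"] 1(1) c by blast
          next
            case (2 b)
            then have "y \<in> points X - (cyl i \<top>\<^bsub>G i\<^esub> - cyl i b)"
              using yX by (simp add: mem_cyl[OF i])
            moreover have "\<top>\<^bsub>G i\<^esub> \<in> P"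
              using P(1) by (simp add: Gi.prime_filters_iff)
            ultimately show ?thesis
              using \<U>_I[of "\<top>\<^bsub>G i\<^esub>" b] 2 c by blast
          qed
        qed
      qed blast
      then obtain a b where ab: "a \<in> carrier (G i)" "b \<in> carrier (G i)" "a \<in> P" "b \<notin> P"
        "?g \<theta> \<subseteq> points X - (cyl i a - cyl i b)"
        unfolding \<U>_def by blast
      then have "\<theta> (points X - (cyl i a - cyl i b))"
        using sub[OF \<theta> diff] cyl_clopen_upset[OF i] by blast
      then have "\<theta> (cyl i (a \<Rrightarrow>\<^bsub>G i\<^esub> b))"
        by (rule S_D(6)[OF \<theta> i ab(1,2)])
      then have "x \<in> cyl i (a \<Rrightarrow>\<^bsub>G i\<^esub> b)"
        using x cyl_clopen_upset[OF i Gi.imp_closed[OF ab(1,2)]] clopen_upsets_clopens by blast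
      then have "a \<Rrightarrow>\<^bsub>G i\<^esub> b \<in> P"
        using P(2) by (auto simp: cyl_def stone_map_def)
      then show False
        using Gi.imp_mem_prime_filter[OF P(1) ab(1,2)] P(1) ab(3,4) by blast
    qed
    have "?g \<theta> \<in> closed_chains X"
      using ne cl ch unfolding closed_chains_def Complete_Partial_Order.chain_def by blast
    then show ?thesis
      unfolding points_Z by (intro conjI ballI impI up)
  qed
  have Zg: "C \<in> ?g ` ?S" if C: "C \<in> points Z" for C
  proof
    have Cc: "C \<noteq> {}" "closedin (otop X) C" "Complete_Partial_Order.chain (ole X) C"
      and up: "\<And>i x P. i \<in> I \<Longrightarrow> x \<in> C \<Longrightarrow> P \<in> prime_filters (G i) \<Longrightarrow> x i \<subseteq> P \<Longrightarrow> \<exists>y\<in>C. y i = P"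
      using C unfolding points_Z closed_chains_def by blast+
    have CX: "C \<subseteq> points X"
      using Cc(2) by (rule closedin_subset)
    \<comment> \<open>The code of \<open>C\<close>, set to false off the clopens.\<close>
    let ?\<theta> = "\<lambda>V. V \<in> clopens X \<and> C \<subseteq> V"
    have "x \<in> C" if x: "x \<in> ?g ?\<theta>" for x
    proof (rule ccontr)
      assume "x \<notin> C"
      moreover have "x \<in> points X"
        using x CX clopens_points[of X] by blast
      ultimately obtain V W where VW: "V \<in> clopen_upsets X" "W \<in> clopen_upsets X" "x \<in> V - W" "C \<inter> (V - W) = {}"
        using X.separate_closed[OF Cc(2)] by metis
      then have "C \<subseteq> points X - (V - W)"
        using CX by blast
      then have "x \<in> points X - (V - W)"
        using x diff[OF VW(1,2)] by blast
      with VW(3) show False by blast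
    qed
    then show "C = ?g ?\<theta>" by blast
    have total: "C \<subseteq> points X - (V - W) \<or> C \<subseteq> points X - (W - V)"
      if V: "V \<in> clopen_upsets X" and W: "W \<in> clopen_upsets X" for V W
    proof (rule ccontr)
      assume "\<not> ?thesis"
      then obtain v w where vw: "v \<in> C" "v \<in> V - W" "w \<in> C" "w \<in> W - V"
        using CX by blast
      have "v \<in> points X" "w \<in> points X"
        using vw CX by blast+
      then show False
        using X.chainD[OF Cc(3) vw(1,3)] clopen_upsetsD[OF V, of v w] clopen_upsetsD[OF W, of w v] vw by blast
    qed
    have imp: "C \<subseteq> cyl i (a \<Rrightarrow>\<^bsub>G i\<^esub> b)"
      if i: "i \<in> I" and ab: "a \<in> carrier (G i)" "b \<in> carrier (G i)"
        and sub': "C \<subseteq> points X - (cyl i a - cyl i b)" for i a b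
    proof
      fix x assume x: "x \<in> C"
      interpret Gi: heyting_algebra "G i" by (rule heyting[OF i])
      have xX: "x \<in> points X"
        using x CX by blast
      have "b \<in> Q" if Q: "Q \<in> prime_filters (G i)" "x i \<subseteq> Q" "a \<in> Q" for Q
      proof -
        obtain y where y: "y \<in> C" "y i = Q"
          using up[OF i x Q(1,2)] by blast
        then have "y \<in> points X" "y \<notin> cyl i a - cyl i b"
          using CX sub' by blast+
        then show ?thesis
          using y(2) Q(3) by (simp add: mem_cyl[OF i])
      qed
      then have "a \<Rrightarrow>\<^bsub>G i\<^esub> b \<in> x i"
        using Gi.imp_mem_prime_filter[OF points_X_D[OF xX i] ab] by blast
      then show "x \<in> cyl i (a \<Rrightarrow>\<^bsub>G i\<^esub> b)"
        by (simp add: mem_cyl[OF i xX])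
    qed
    have cyl': "cyl i (a \<Rrightarrow>\<^bsub>G i\<^esub> b) \<in> clopens X"
      if "i \<in> I" "a \<in> carrier (G i)" "b \<in> carrier (G i)" for i a b
      using that by (intro clopen_upsets_clopens cyl_clopen_upset heyting_algebra.imp_closed heyting)
    show "?\<theta> \<in> ?S"
      unfolding mem_Collect_eq
    proof (intro conjI)
      show "points X \<in> clopens X" "C \<subseteq> points X" "\<not> ({} \<in> clopens X \<and> C \<subseteq> {})"
        using CX Cc(1) clopens_points by auto
    qed (use clopens_Int[of _ X] total diff imp cyl' in auto)
  qed
  have S: "?g ` ?S = points Z"
    by (rule subset_antisym[OF image_subsetI[OF gZ] subsetI[OF Zg]])
  have "closed ?S"
    by (intro closed_Collect_conj closed_Collect_all closed_Collect_imp closed_Collect_disj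
      open_Collect_conj open_Collect_disj closed_coord closed_ncoord open_coord
      closed_Collect_const open_Collect_const)
  then have "compactin (topology_generated_by (Box X ` clopens X \<union> Diamond X ` clopens X)) (?g ` ?S)"
  proof (rule compactin_cantor_image)
    have chain: "?g \<theta> \<in> closed_chains X" if "\<theta> \<in> ?S" for \<theta>
      using gZ[OF that] unfolding points_Z by (rule conjunct1)
    fix U assume "U \<in> Box X ` clopens X \<union> Diamond X ` clopens X"
    then consider V where "V \<in> clopens X" "U = Box X V" | V where "V \<in> clopens X" "U = Diamond X V"
      by blast
    then show "\<exists>V. open V \<and> (\<forall>\<theta>\<in>?S. ?g \<theta> \<in> U \<longleftrightarrow> \<theta> \<in> V)"
    proof cases
      case (1 V)
      have "\<forall>\<theta>\<in>?S. ?g \<theta> \<in> U \<longleftrightarrow> \<theta> \<in> {\<theta>. \<theta> V}"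
      proof
        fix \<theta> assume "\<theta> \<in> ?S"
        from sub[OF this 1(1)] chain[OF this] show "?g \<theta> \<in> U \<longleftrightarrow> \<theta> \<in> {\<theta>. \<theta> V}"
          by (simp only: 1(2) Box_def mem_Collect_eq simp_thms)
      qed
      then show ?thesis
        by (intro exI[of _ "{\<theta>. \<theta> V}"] conjI open_coord)
    next
      case (2 V)
      \<comment> \<open>A diamond is read off the complementary coordinate: a chain meets
        \<open>V\<close> iff it does not lie in the complement of \<open>V\<close>.\<close>
      have "\<forall>\<theta>\<in>?S. ?g \<theta> \<in> U \<longleftrightarrow> \<theta> \<in> {\<theta>. \<not> \<theta> (points X - V)}"
      proof
        fix \<theta> assume \<theta>: "\<theta> \<in> ?S"
        have c: "points X - V \<in> clopens X"
          using 2(1) by (intro clopens_Diff clopens_points)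
        have "?g \<theta> \<subseteq> points X"
          using chain[OF \<theta>] closedin_subset unfolding closed_chains_def by blast
        then have "?g \<theta> \<inter> V \<noteq> {} \<longleftrightarrow> \<not> ?g \<theta> \<subseteq> points X - V" by blast
        also have "\<dots> \<longleftrightarrow> \<not> \<theta> (points X - V)"
          unfolding sub[OF \<theta> c] ..
        finally show "?g \<theta> \<in> U \<longleftrightarrow> \<theta> \<in> {\<theta>. \<not> \<theta> (points X - V)}"
          using chain[OF \<theta>] by (simp only: 2(2) Diamond_def mem_Collect_eq simp_thms)
      qed
      then show ?thesis
        by (intro exI[of _ "{\<theta>. \<not> \<theta> (points X - V)}"] conjI open_ncoord)
    qed
  next
    have "points Z \<subseteq> closed_chains X"
      unfolding points_tensor by blast
    also have "\<dots> = \<Union> (Box X ` clopens X \<union> Diamond X ` clopens X)"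
      using points_CC[of X] by (simp add: CC_def)
    finally show "?g ` ?S \<subseteq> \<Union> (Box X ` clopens X \<union> Diamond X ` clopens X)"
      unfolding S .
  qed
  then show ?thesis
    unfolding S by (simp add: CC_def)
qed

text \<open>For closure under upsets, a point \<open>y\<close> of \<open>C\<close> with
  \<open>y i = P\<close> is either above \<open>x\<close>, hence in \<open>D\<close>, or below
  \<open>x\<close>. In the second case \<open>P = y i \<subseteq> x i \<subseteq> P\<close>, so
  \<open>x\<close> itself projects to \<open>P\<close>.\<close>

sublocale Z: chain_space X "points Z"
proof
  show "points Z \<subseteq> closed_chains X"
    using points_Z by (intro subsetI) simp
  show "D \<in> points Z" if C: "C \<in> points Z" and D: "D \<in> closed_chains X" and up: "is_upset (ole X) C D" for C D
    unfolding points_Z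
  proof (intro conjI ballI impI)
    fix i x P assume i: "i \<in> I" and x: "x \<in> D" and P: "P \<in> prime_filters (G i)" "x i \<subseteq> P"
    have DC: "D \<subseteq> C" and upD: "\<And>u v. u \<in> D \<Longrightarrow> v \<in> C \<Longrightarrow> ole X u v \<Longrightarrow> v \<in> D"
      using up by (auto simp: is_upset_def)
    have "C \<in> closed_chains X"
      using C by (simp add: points_Z)
    then have ch: "Complete_Partial_Order.chain (ole X) C"
      by (simp add: closed_chains_def)
    have xC: "x \<in> C"
      using DC x by blast
    obtain y where y: "y \<in> C" "y i = P"
      using C i xC P unfolding points_Z by metis
    show "\<exists>y\<in>D. y i = P"
    proof (cases "ole X x y")
      case True
      with y show ?thesis
        using upD[OF x y(1)] by blast
    next
      case False
      then have "ole X y x"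
        using X.chainD[OF ch xC y(1)] by blast
      then have "x i = P"
        using i y(2) P(2) by (auto simp: ole_X)
      with x show ?thesis by blast
    qed
  qed (rule D)
  show "compactin (otop (CC X)) (points Z)"
    by (rule compact_points_Z)
qed

section \<open>The coprojections and generation by their images\<close>

lemma Z_Y: "Z.Y = Z"
  unfolding Z.Y_def unfolding points_tensor unfolding tensor_def by (rule refl)

lemma coprod_map_box: "coprod_map I G i a = {C \<in> points Z. C \<subseteq> cyl i a}"
  unfolding coprod_map_eq cyl_def ..

lemma coprod_map_clopen_upset:
  assumes "i \<in> I" "a \<in> carrier (G i)"
  shows "coprod_map I G i a \<in> clopen_upsets Z"
  unfolding coprod_map_box
  using Z.box_upset[OF clopen_upsets_clopens[OF cyl_clopen_upset[OF assms]]] by (simp only: Z_Y)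

text \<open>By \<open>imp_box\<close> it remains to compare
  \<open>C \<inter> cyl i a \<subseteq> cyl i b\<close> with
  \<open>C \<subseteq> cyl i (a \<Rrightarrow> b)\<close>. If \<open>a \<Rrightarrow> b\<close> is
  missing from \<open>x i\<close>, some prime filter above \<open>x i\<close> contains
  \<open>a\<close> and not \<open>b\<close>, and the upset condition on the projection realises it
  by a point of \<open>C\<close>. This is what that condition in the tensor product is for.\<close>

lemma coprod_map_imp:
  assumes i: "i \<in> I" and ab: "a \<in> carrier (G i)" "b \<in> carrier (G i)"
  shows "points Z - downset Z (coprod_map I G i a - coprod_map I G i b) = coprod_map I G i (a \<Rrightarrow>\<^bsub>G i\<^esub> b)"
proof -
  interpret Gi: heyting_algebra "G i" by (rule heyting[OF i])
  have "C \<inter> cyl i a \<subseteq> cyl i b \<longleftrightarrow> C \<subseteq> cyl i (a \<Rrightarrow>\<^bsub>G i\<^esub> b)" if C: "C \<in> points Z" for C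
  proof -
    have CX: "C \<subseteq> points X"
      by (rule Z.T_D(3)[OF C])
    have "(\<forall>x\<in>C. a \<in> x i \<longrightarrow> b \<in> x i) \<longleftrightarrow> (\<forall>x\<in>C. a \<Rrightarrow>\<^bsub>G i\<^esub> b \<in> x i)"
    proof (intro iffI ballI impI)
      fix x assume *: "\<forall>x\<in>C. a \<in> x i \<longrightarrow> b \<in> x i" and x: "x \<in> C"
      have pf: "x i \<in> prime_filters (G i)"
        using points_X_D CX x i by blast
      have "b \<in> Q" if Q: "Q \<in> prime_filters (G i)" "x i \<subseteq> Q" "a \<in> Q" for Q
      proof -
        obtain y where "y \<in> C" "y i = Q"
          using C i x Q(1,2) unfolding points_Z by metis
        with * Q(3) show ?thesis by blast
      qed
      then show "a \<Rrightarrow>\<^bsub>G i\<^esub> b \<in> x i"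
        using Gi.imp_mem_prime_filter[OF pf ab] by blast
    next
      fix x assume *: "\<forall>x\<in>C. a \<Rrightarrow>\<^bsub>G i\<^esub> b \<in> x i" and x: "x \<in> C" "a \<in> x i"
      have pf: "x i \<in> prime_filters (G i)"
        using points_X_D CX x(1) i by blast
      show "b \<in> x i"
        using Gi.imp_mem_prime_filter[OF pf ab] pf * x by blast
    qed
    then show ?thesis
      using CX mem_cyl[OF i] by (meson IntE IntI subset_iff)
  qed
  then have "{C \<in> points Z. C \<inter> cyl i a \<subseteq> cyl i b} = {C \<in> points Z. C \<subseteq> cyl i (a \<Rrightarrow>\<^bsub>G i\<^esub> b)}"
    by (intro Collect_cong conj_cong refl)
  with Z.imp_box[OF cyl_clopen_upset[OF i ab(1)] cyl_clopen_upset[OF i ab(2)]] show ?thesis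
    unfolding coprod_map_box Z_Y by simp
qed

lemma coprod_map_hom:
  assumes i: "i \<in> I"
  shows "coprod_map I G i \<in> heyting_hom (G i) (upset_algebra Z)"
proof -
  note cu = coprod_map_clopen_upset[OF i]
  have bot: "coprod_map I G i \<bottom>\<^bsub>G i\<^esub> = {}"
    using Z.T_D(1) by (auto simp: coprod_map_box cyl_bot[OF i])
  have top: "coprod_map I G i \<top>\<^bsub>G i\<^esub> = points Z"
    using Z.T_D(3) by (auto simp: coprod_map_box cyl_top[OF i])
  have meet: "coprod_map I G i (a \<sqinter>\<^bsub>G i\<^esub> b) = coprod_map I G i a \<inter> coprod_map I G i b"
    if "a \<in> carrier (G i)" "b \<in> carrier (G i)" for a b
    using that by (auto simp: coprod_map_box cyl_meet[OF i])
  have join: "coprod_map I G i (a \<squnion>\<^bsub>G i\<^esub> b) = coprod_map I G i a \<union> coprod_map I G i b"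
    if "a \<in> carrier (G i)" "b \<in> carrier (G i)" for a b
    using that unfolding coprod_map_box by (simp only: cyl_join[OF i] Z.box_Un cyl_clopen_upset[OF i])
  show ?thesis
    unfolding heyting_hom_def mem_Collect_eq
  proof (intro conjI ballI)
    show "coprod_map I G i \<in> carrier (G i) \<rightarrow> carrier (upset_algebra Z)"
      using cu by (simp add: upset_algebra_simps)
  qed (simp_all only: upset_algebra_simps cu bot top meet join coprod_map_imp[OF i])
qed

text \<open>There are two rounds of generation. In the product, cylinders separate points, so
  lattice operations on them reach every clopen upset, and boxes respect these operations by
  \<open>box_Un\<close>. In the chain space, boxes generate everything by
  \<open>upset_algebra_induct\<close>.\<close>

lemma coproduct_induct [consumes 1, case_names coprod_map bot top Int Un imp]:
  assumes "U \<in> clopen_upsets Z"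
    and gen: "\<And>i a. i \<in> I \<Longrightarrow> a \<in> carrier (G i) \<Longrightarrow> P (coprod_map I G i a)"
    and bot: "P {}" and top: "P (points Z)"
    and Int: "\<And>U V. U \<in> clopen_upsets Z \<Longrightarrow> V \<in> clopen_upsets Z \<Longrightarrow> P U \<Longrightarrow> P V \<Longrightarrow> P (U \<inter> V)"
    and Un: "\<And>U V. U \<in> clopen_upsets Z \<Longrightarrow> V \<in> clopen_upsets Z \<Longrightarrow> P U \<Longrightarrow> P V \<Longrightarrow> P (U \<union> V)"
    and imp: "\<And>U V. U \<in> clopen_upsets Z \<Longrightarrow> V \<in> clopen_upsets Z \<Longrightarrow> P U \<Longrightarrow> P V \<Longrightarrow>
      P (points Z - downset Z (U - V))"
  shows "P U"
proof -
  have boxcu: "{C \<in> points Z. C \<subseteq> V} \<in> clopen_upsets Z" if "V \<in> clopen_upsets X" for V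
    using Z.box_upset[OF clopen_upsets_clopens[OF that]] by (simp only: Z_Y)
  let ?\<V> = "{V \<in> clopen_upsets X. P {C \<in> points Z. C \<subseteq> V}}"
  have "clopen_upsets X \<subseteq> ?\<V>"
  proof (rule X.separating_sublattice)
    have 0: "{C \<in> points Z. C \<subseteq> {}} = {}"
      using Z.T_D(1) by blast
    show "{} \<in> ?\<V>"
      by (simp only: mem_Collect_eq 0 bot empty_clopen_upsets simp_thms)
    have 1: "{C \<in> points Z. C \<subseteq> points X} = points Z"
      using Z.T_D(3) by blast
    show "points X \<in> ?\<V>"
      by (simp only: mem_Collect_eq 1 top points_clopen_upsets simp_thms)
    show "V \<inter> W \<in> ?\<V>" if "V \<in> ?\<V>" "W \<in> ?\<V>" for V W
    proof -
      have "{C \<in> points Z. C \<subseteq> V \<inter> W} = {C \<in> points Z. C \<subseteq> V} \<inter> {C \<in> points Z. C \<subseteq> W}" by blast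
      then show ?thesis
        using that Int[OF boxcu boxcu, of V W] clopen_upsets_Int[of V X W] by simp
    qed
    show "V \<union> W \<in> ?\<V>" if "V \<in> ?\<V>" "W \<in> ?\<V>" for V W
      using that Un[OF boxcu boxcu, of V W] clopen_upsets_Un[of V X W] Z.box_Un[of V W] by simp
    show "\<exists>U\<in>?\<V>. x \<in> U \<and> y \<notin> U" if xy: "x \<in> points X" "y \<in> points X" "\<not> ole X x y" for x y
    proof -
      obtain i a where ia: "i \<in> I" "a \<in> x i" "a \<notin> y i"
        using xy(3) by (auto simp: ole_X)
      then have a: "a \<in> carrier (G i)"
        using points_X_D[OF xy(1) ia(1)] by (auto simp: prime_filters_def is_upset_def)
      have "cyl i a \<in> ?\<V>"
        using cyl_clopen_upset[OF ia(1) a] gen[OF ia(1) a] by (simp add: coprod_map_box)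
      moreover have "x \<in> cyl i a" "y \<notin> cyl i a"
        using ia xy by (simp_all add: mem_cyl)
      ultimately show ?thesis by blast
    qed
  qed blast
  then have box: "P {C \<in> points Z. C \<subseteq> V}" if "V \<in> clopen_upsets X" for V
    using that by blast
  show ?thesis
    using Z.upset_algebra_induct[of U P, unfolded Z_Y] assms(1) box imp Un Int by simp
qed

lemma godel_Z: "godel_algebra (upset_algebra Z)"
  using Z.godel_Y by (simp only: Z_Y)

lemma imp_clopen_upset_Z:
  "U \<in> clopen_upsets Z \<Longrightarrow> V \<in> clopen_upsets Z \<Longrightarrow> points Z - downset Z (U - V) \<in> clopen_upsets Z"
  using Z.imp_clopen_upset by (simp only: Z_Y)

end

section \<open>The mediating homomorphism\<close>

locale godel_cocone = godel_family I G + H: godel_algebra H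
  for I :: "'i set" and G :: "'i \<Rightarrow> 'a heyting" and H :: "'c heyting" +
  fixes f :: "'i \<Rightarrow> 'a \<Rightarrow> 'c"
  assumes f_hom: "i \<in> I \<Longrightarrow> f i \<in> heyting_hom (G i) H"
begin

lemma
  assumes i: "i \<in> I"
  shows f_closed: "a \<in> carrier (G i) \<Longrightarrow> f i a \<in> carrier H"
    and f_bot: "f i \<bottom>\<^bsub>G i\<^esub> = \<bottom>\<^bsub>H\<^esub>"
    and f_top: "f i \<top>\<^bsub>G i\<^esub> = \<top>\<^bsub>H\<^esub>"
    and f_meet: "a \<in> carrier (G i) \<Longrightarrow> b \<in> carrier (G i) \<Longrightarrow> f i (a \<sqinter>\<^bsub>G i\<^esub> b) = f i a \<sqinter>\<^bsub>H\<^esub> f i b"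
    and f_join: "a \<in> carrier (G i) \<Longrightarrow> b \<in> carrier (G i) \<Longrightarrow> f i (a \<squnion>\<^bsub>G i\<^esub> b) = f i a \<squnion>\<^bsub>H\<^esub> f i b"
    and f_imp: "a \<in> carrier (G i) \<Longrightarrow> b \<in> carrier (G i) \<Longrightarrow> f i (a \<Rrightarrow>\<^bsub>G i\<^esub> b) = f i a \<Rrightarrow>\<^bsub>H\<^esub> f i b"
  using f_hom[OF i] unfolding heyting_hom_def by auto

section \<open>Prime filters pulled back along the cocone\<close>

definition pullback :: "'c set \<Rightarrow> 'i \<Rightarrow> 'a set" where
  "pullback Q = (\<lambda>i\<in>I. {a \<in> carrier (G i). f i a \<in> Q})"

text \<open>The Esakia morphism dual to the mediating homomorphism.\<close>

definition \<phi> :: "'c set \<Rightarrow> ('i \<Rightarrow> 'a set) set" where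
  "\<phi> P = pullback ` {Q \<in> prime_filters H. P \<subseteq> Q}"

lemma mem_pullback: "i \<in> I \<Longrightarrow> a \<in> pullback Q i \<longleftrightarrow> a \<in> carrier (G i) \<and> f i a \<in> Q"
  by (simp add: pullback_def)

lemma pullback_prime:
  assumes i: "i \<in> I" and Q: "Q \<in> prime_filters H"
  shows "pullback Q i \<in> prime_filters (G i)"
proof -
  interpret Gi: heyting_algebra "G i" by (rule heyting[OF i])
  show ?thesis
    using Q unfolding Gi.prime_filters_iff H.prime_filters_iff
    by (auto simp: mem_pullback[OF i] f_closed[OF i] f_bot[OF i] f_top[OF i] f_meet[OF i] f_join[OF i])
qed

lemma pullback_points: "Q \<in> prime_filters H \<Longrightarrow> pullback Q \<in> points X"
  unfolding points_X using pullback_prime by (auto simp: PiE_iff) (simp add: pullback_def)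

lemma pullback_mono: "Q \<subseteq> Q' \<Longrightarrow> ole X (pullback Q) (pullback Q')"
  by (auto simp: ole_X mem_pullback)

text \<open>Serves to show that \<open>\<phi> P\<close> is closed, being the image of a compact set
  of prime filters.\<close>

lemma pullback_continuous: "continuous_map (otop (dual_space H)) (otop X) pullback"
  unfolding prod_ospace_def ospace.simps continuous_map_componentwise
proof (intro conjI ballI)
  show "pullback ` points (dual_space H) \<subseteq> extensional I"
    by (auto simp: pullback_def)
  fix i assume i: "i \<in> I"
  have pre: "stone_map H (f i a) \<in> clopens (dual_space H)" if "a \<in> carrier (G i)" for a
    using that by (intro clopen_upsets_clopens H.stone_map_clopen_upset f_closed[OF i])
  show "continuous_map (otop (dual_space H)) (otop (dual_space (G i))) (\<lambda>Q. pullback Q i)"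
    unfolding dual_space_def[of "G i"] ospace.simps
  proof (rule continuous_on_generated_topo)
    fix U assume "U \<in> stone_map (G i) ` carrier (G i) \<union>
      (\<lambda>a. prime_filters (G i) - stone_map (G i) a) ` carrier (G i)"
    then consider a where "a \<in> carrier (G i)" "U = stone_map (G i) a"
      | a where "a \<in> carrier (G i)" "U = prime_filters (G i) - stone_map (G i) a" by blast
    then show "openin (otop (dual_space H)) ((\<lambda>Q. pullback Q i) -` U \<inter> points (dual_space H))"
    proof cases
      case (1 a)
      have "(\<lambda>Q. pullback Q i) -` U \<inter> points (dual_space H) = stone_map H (f i a)"
        using 1 pullback_prime[OF i] by (auto simp: H.points_dual stone_map_def mem_pullback[OF i])
      with pre[OF 1(1)] show ?thesis
        by (simp add: clopens_def)
    next
      case (2 a)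
      have "(\<lambda>Q. pullback Q i) -` U \<inter> points (dual_space H) = points (dual_space H) - stone_map H (f i a)"
        using 2 pullback_prime[OF i] by (auto simp: H.points_dual stone_map_def mem_pullback[OF i])
      with clopens_Diff[OF clopens_points pre[OF 2(1)]] show ?thesis
        by (simp add: clopens_def)
    qed
  next
    have "\<Union> (stone_map (G i) ` carrier (G i) \<union>
        (\<lambda>a. prime_filters (G i) - stone_map (G i) a) ` carrier (G i)) = points (dual_space (G i))"
      by (simp add: dual_space_def)
    also have "\<dots> = prime_filters (G i)"
      by (rule heyting_algebra.points_dual[OF heyting[OF i]])
    finally show "(\<lambda>Q. pullback Q i) ` points (dual_space H) \<subseteq> \<Union> (stone_map (G i) ` carrier (G i) \<union>
        (\<lambda>a. prime_filters (G i) - stone_map (G i) a) ` carrier (G i))"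
      using pullback_prime[OF i] by (simp add: H.points_dual image_subset_iff)
  qed
qed

text \<open>The chain property comes from \<open>prime_filters_root\<close> in \<open>H\<close>. The
  upset condition is the lifting property dual to the preservation of implications by
  \<open>f i\<close>: given \<open>Q\<close> and a prime filter \<open>R\<close> above
  \<open>pullback Q i\<close>, separation yields \<open>S\<close> above \<open>Q\<close> with
  \<open>pullback S i = R\<close>.\<close>

lemma \<phi>_points:
  assumes P: "P \<in> prime_filters H"
  shows "\<phi> P \<in> points Z"
proof -
  interpret HD: priestley_space "dual_space H" by (rule H.priestley_dual)
  have "closedin (otop (dual_space H)) {Q \<in> prime_filters H. P \<subseteq> Q}"
    using HD.closedin_up[of P] P by (simp add: H.points_dual H.ole_dual)
  then have "compactin (otop X) (\<phi> P)"
    unfolding \<phi>_def by (intro image_compactin[OF _ pullback_continuous] HD.closedin_compactin)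
  then have "closedin (otop X) (\<phi> P)"
    by (rule compactin_imp_closedin[OF X.Hausdorff])
  moreover have "\<phi> P \<noteq> {}"
    using P by (auto simp: \<phi>_def)
  moreover have "Complete_Partial_Order.chain (ole X) (\<phi> P)"
    unfolding Complete_Partial_Order.chain_def
  proof (intro ballI)
    fix x y assume "x \<in> \<phi> P" "y \<in> \<phi> P"
    then obtain Q R where *: "Q \<in> prime_filters H" "P \<subseteq> Q" "x = pullback Q"
      "R \<in> prime_filters H" "P \<subseteq> R" "y = pullback R"
      by (auto simp: \<phi>_def)
    show "ole X x y \<or> ole X y x"
      using H.prime_filters_root[OF P *(1,4,2,5)] pullback_mono *(3,6) by blast
  qed
  ultimately have "\<phi> P \<in> closed_chains X"
    by (simp add: closed_chains_def)
  moreover have "\<exists>y\<in>\<phi> P. y i = R"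
    if i: "i \<in> I" and x: "x \<in> \<phi> P" and R: "R \<in> prime_filters (G i)" "x i \<subseteq> R" for i x R
  proof -
    interpret Gi: heyting_algebra "G i" by (rule heyting[OF i])
    obtain Q where Q: "Q \<in> prime_filters H" "P \<subseteq> Q" "x = pullback Q"
      using x by (auto simp: \<phi>_def)
    have Qc: "Q \<subseteq> carrier H" and Rc: "R \<subseteq> carrier (G i)" and tops: "\<top>\<^bsub>H\<^esub> \<in> Q" "\<top>\<^bsub>G i\<^esub> \<in> R"
      and botR: "\<bottom>\<^bsub>G i\<^esub> \<notin> R"
      using Q(1) R(1) by (simp_all add: H.prime_filters_iff Gi.prime_filters_iff)
    have Qm: "\<And>u v. u \<in> Q \<Longrightarrow> v \<in> Q \<Longrightarrow> u \<sqinter>\<^bsub>H\<^esub> v \<in> Q" and Rm: "\<And>u v. u \<in> R \<Longrightarrow> v \<in> R \<Longrightarrow> u \<sqinter>\<^bsub>G i\<^esub> v \<in> R"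
      using Q(1) R(1) by (auto simp: prime_filters_def)
    \<comment> \<open>Containing \<open>?A\<close> forces \<open>S\<close> to contain
      \<open>Q\<close> and the image of \<open>R\<close>, and missing \<open>?B\<close> keeps the
      image of everything outside \<open>R\<close> out of \<open>S\<close>. If
      \<open>q \<sqinter> f i r\<close> were below \<open>f i s\<close>, then \<open>q\<close> would
      be below \<open>f i (r \<Rrightarrow> s)\<close>, so \<open>r \<Rrightarrow> s\<close> would
      lie in \<open>pullback Q i \<subseteq> R\<close>, and \<open>s\<close> with it.\<close>
    let ?A = "{q \<sqinter>\<^bsub>H\<^esub> f i r |q r. q \<in> Q \<and> r \<in> R}" and ?B = "f i ` (carrier (G i) - R)"
    have "\<exists>S\<in>prime_filters H. ?A \<subseteq> S \<and> S \<inter> ?B = {}"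
    proof (rule H.prime_filter_separation[of ?A ?B])
      show "?A \<subseteq> carrier H"
        using H.meet_closed[OF subsetD[OF Qc] f_closed[OF i subsetD[OF Rc]]] by blast
      show "?A \<noteq> {}" "?B \<noteq> {}"
        using tops botR by auto
      show "?B \<subseteq> carrier H"
        using f_closed[OF i] by auto
      show "u \<sqinter>\<^bsub>H\<^esub> v \<in> ?A" if uv: "u \<in> ?A" "v \<in> ?A" for u v
      proof -
        obtain q r q' r' where *: "q \<in> Q" "r \<in> R" "q' \<in> Q" "r' \<in> R" "u = q \<sqinter>\<^bsub>H\<^esub> f i r" "v = q' \<sqinter>\<^bsub>H\<^esub> f i r'"
          using uv by blast
        have c: "q \<in> carrier H" "q' \<in> carrier H" "r \<in> carrier (G i)" "r' \<in> carrier (G i)"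
          using * Qc Rc by auto
        have "u \<sqinter>\<^bsub>H\<^esub> v = (q \<sqinter>\<^bsub>H\<^esub> q') \<sqinter>\<^bsub>H\<^esub> f i (r \<sqinter>\<^bsub>G i\<^esub> r')"
          using *(5,6) c f_closed[OF i] by (simp add: f_meet[OF i] H.meet_interchange)
        with Qm[OF *(1,3)] Rm[OF *(2,4)] show ?thesis by blast
      qed
      show "u \<squnion>\<^bsub>H\<^esub> v \<in> ?B" if uv: "u \<in> ?B" "v \<in> ?B" for u v
      proof -
        obtain r r' where *: "r \<in> carrier (G i)" "r \<notin> R" "r' \<in> carrier (G i)" "r' \<notin> R" "u = f i r" "v = f i r'"
          using uv by blast
        have "u \<squnion>\<^bsub>H\<^esub> v = f i (r \<squnion>\<^bsub>G i\<^esub> r')"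
          using * by (simp add: f_join[OF i])
        moreover have "r \<squnion>\<^bsub>G i\<^esub> r' \<in> carrier (G i) - R"
          using * R(1) by (simp add: Gi.prime_filters_iff)
        ultimately show ?thesis by blast
      qed
      show "\<not> u \<sqsubseteq>\<^bsub>H\<^esub> v" if uv: "u \<in> ?A" "v \<in> ?B" for u v
      proof
        assume le: "u \<sqsubseteq>\<^bsub>H\<^esub> v"
        obtain q r s where *: "q \<in> Q" "r \<in> R" "s \<in> carrier (G i)" "s \<notin> R" "u = q \<sqinter>\<^bsub>H\<^esub> f i r" "v = f i s"
          using uv by blast
        have c: "q \<in> carrier H" "r \<in> carrier (G i)"
          using * Qc Rc by auto
        have "q \<sqsubseteq>\<^bsub>H\<^esub> f i (r \<Rrightarrow>\<^bsub>G i\<^esub> s)"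
          using le H.residuation[of "f i r" "f i s" q] c * by (simp add: f_imp[OF i] f_closed[OF i])
        then have "f i (r \<Rrightarrow>\<^bsub>G i\<^esub> s) \<in> Q"
          using H.prime_filter_mono[OF Q(1) *(1)] f_closed[OF i] Gi.imp_closed c(2) *(3) by simp
        then have "r \<Rrightarrow>\<^bsub>G i\<^esub> s \<in> R"
          using R(2) Q(3) Gi.imp_closed[OF c(2) *(3)] mem_pullback[OF i] by blast
        then show False
          using Gi.imp_mem_prime_filter[OF R(1) c(2) *(3)] R(1) *(2,4) by blast
      qed
    qed blast
    then obtain S where S: "S \<in> prime_filters H" "?A \<subseteq> S" "S \<inter> ?B = {}" by blast
    have qr: "q \<in> S \<and> f i r \<in> S" if "q \<in> Q" "r \<in> R" for q r
    proof -
      have "q \<sqinter>\<^bsub>H\<^esub> f i r \<in> S" "q \<in> carrier H" "f i r \<in> carrier H"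
        using S(2) that Qc Rc f_closed[OF i] by blast+
      with S(1) show ?thesis
        by (simp add: H.prime_filters_iff)
    qed
    then have "Q \<subseteq> S" "\<And>r. r \<in> R \<Longrightarrow> f i r \<in> S"
      using tops by blast+
    then have "pullback S i = R"
      using S(3) Rc by (auto simp: mem_pullback[OF i])
    moreover have "pullback S \<in> \<phi> P"
      using S(1) Q(2) \<open>Q \<subseteq> S\<close> by (auto simp: \<phi>_def)
    ultimately show ?thesis by blast
  qed
  ultimately show ?thesis
    unfolding points_Z by (intro conjI ballI impI)
qed

text \<open>As \<open>pullback\<close> need not be injective, an element of \<open>\<phi> P\<close>
  above \<open>pullback Q1\<close> may come from a prime filter \<open>P1\<close> below
  \<open>Q1\<close>. Then the two pullbacks are equal by antisymmetry, so the element is in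
  \<open>\<phi> Q\<close> all the same.\<close>

lemma \<phi>_mono:
  assumes P: "P \<in> prime_filters H" and Q: "Q \<in> prime_filters H" and PQ: "P \<subseteq> Q"
  shows "is_upset (ole X) (\<phi> P) (\<phi> Q)"
  unfolding is_upset_def
proof (intro conjI ballI impI)
  show "\<phi> Q \<subseteq> \<phi> P"
    using PQ by (auto simp: \<phi>_def)
  fix x y assume "x \<in> \<phi> Q" "y \<in> \<phi> P" and le: "ole X x y"
  then obtain Q1 P1 where *: "Q1 \<in> prime_filters H" "Q \<subseteq> Q1" "x = pullback Q1"
    "P1 \<in> prime_filters H" "P \<subseteq> P1" "y = pullback P1"
    by (auto simp: \<phi>_def)
  have "P \<subseteq> Q1"
    using PQ *(2) by blast
  from H.prime_filters_root[OF P *(1,4) this *(5)] consider "Q1 \<subseteq> P1" | "P1 \<subseteq> Q1" by blast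
  then show "y \<in> \<phi> Q"
  proof cases
    case 1
    with * show ?thesis by (auto simp: \<phi>_def)
  next
    case 2
    then have "ole X y x"
      using * pullback_mono by blast
    then have "x = y"
      using le X.antisym pullback_points * by blast
    with \<open>x \<in> \<phi> Q\<close> show ?thesis by simp
  qed
qed

text \<open>The closed chain \<open>D\<close> has a least point \<open>m\<close>, which is the
  pullback of some \<open>Q\<close> above \<open>P\<close>. Both \<open>D\<close> and
  \<open>\<phi> Q\<close> are then upsets of \<open>\<phi> P\<close> with least point
  \<open>m\<close>, so they coincide. This is the back condition of a p-morphism.\<close>

lemma \<phi>_lift:
  assumes P: "P \<in> prime_filters H" and D: "D \<in> points Z" and up: "is_upset (ole X) (\<phi> P) D"
  shows "\<exists>Q\<in>prime_filters H. P \<subseteq> Q \<and> \<phi> Q = D"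
proof -
  note Dc = Z.T_D[OF D]
  obtain m where m: "m \<in> D" "\<And>x. x \<in> D \<Longrightarrow> ole X m x"
    using X.chain_least[OF Dc(2,1,4)] by blast
  have D\<phi>: "D \<subseteq> \<phi> P" and upD: "\<And>x y. x \<in> D \<Longrightarrow> y \<in> \<phi> P \<Longrightarrow> ole X x y \<Longrightarrow> y \<in> D"
    using up by (auto simp: is_upset_def)
  then obtain Q where Q: "Q \<in> prime_filters H" "P \<subseteq> Q" "m = pullback Q"
    using m(1) by (auto simp: \<phi>_def)
  have "\<phi> Q \<subseteq> D"
  proof
    fix x assume "x \<in> \<phi> Q"
    then obtain R where R: "R \<in> prime_filters H" "Q \<subseteq> R" "x = pullback R"
      by (auto simp: \<phi>_def)
    then have "x \<in> \<phi> P" "ole X m x"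
      using Q pullback_mono by (auto simp: \<phi>_def)
    then show "x \<in> D"
      using upD[OF m(1)] by blast
  qed
  moreover have "D \<subseteq> \<phi> Q"
  proof
    fix x assume x: "x \<in> D"
    have "m \<in> \<phi> Q"
      using Q by (auto simp: \<phi>_def)
    then show "x \<in> \<phi> Q"
      using \<phi>_mono[OF P Q(1,2)] x D\<phi> m(2)[OF x] by (auto simp: is_upset_def)
  qed
  ultimately show ?thesis
    using Q by blast
qed

text \<open>Pointwise form of saying that the preimage of \<open>U\<close> under
  \<open>\<phi>\<close> is the Stone set of \<open>a\<close>. Naming the element of \<open>H\<close>
  turns the Heyting operations on such \<open>U\<close> into calculations with prime
  filters.\<close>

definition represents :: "('i \<Rightarrow> 'a set) set set \<Rightarrow> 'c \<Rightarrow> bool" where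
  "represents U a \<longleftrightarrow> a \<in> carrier H \<and> (\<forall>P\<in>prime_filters H. \<phi> P \<in> U \<longleftrightarrow> a \<in> P)"

text \<open>Elements of \<open>H\<close> are determined by the prime filters that contain
  them.\<close>

lemma represents_unique:
  assumes "represents U a" "represents U b"
  shows "a = b"
proof -
  have c: "a \<in> carrier H" "b \<in> carrier H" and "\<forall>P\<in>prime_filters H. a \<in> P \<longleftrightarrow> b \<in> P"
    using assms by (auto simp: represents_def)
  then have "a \<sqsubseteq>\<^bsub>H\<^esub> b" "b \<sqsubseteq>\<^bsub>H\<^esub> a"
    using H.le_iff_prime_filters by simp_all
  then show ?thesis
    using c by (rule H.le_antisym)
qed

lemma represents_coprod_map:
  assumes i: "i \<in> I" and a: "a \<in> carrier (G i)"
  shows "represents (coprod_map I G i a) (f i a)"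
  unfolding represents_def
proof (intro conjI ballI)
  show "f i a \<in> carrier H"
    using f_closed[OF i a] .
  fix P assume P: "P \<in> prime_filters H"
  have "\<phi> P \<in> coprod_map I G i a \<longleftrightarrow> (\<forall>Q\<in>prime_filters H. P \<subseteq> Q \<longrightarrow> pullback Q \<in> cyl i a)"
    using \<phi>_points[OF P] unfolding coprod_map_box by (auto simp: \<phi>_def)
  also have "\<dots> \<longleftrightarrow> (\<forall>Q\<in>prime_filters H. P \<subseteq> Q \<longrightarrow> f i a \<in> Q)"
    using mem_cyl[OF i pullback_points] mem_pullback[OF i] a by simp
  also have "\<dots> \<longleftrightarrow> f i a \<in> P"
    using P by blast
  finally show "\<phi> P \<in> coprod_map I G i a \<longleftrightarrow> f i a \<in> P" .
qed

lemma represents_bot: "represents {} \<bottom>\<^bsub>H\<^esub>"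
  by (simp add: represents_def H.prime_filters_iff)

lemma represents_top: "represents (points Z) \<top>\<^bsub>H\<^esub>"
  using \<phi>_points by (simp add: represents_def H.prime_filters_iff)

lemma represents_Int: "represents U a \<Longrightarrow> represents V b \<Longrightarrow> represents (U \<inter> V) (a \<sqinter>\<^bsub>H\<^esub> b)"
  by (simp add: represents_def H.prime_filters_iff)

lemma represents_Un: "represents U a \<Longrightarrow> represents V b \<Longrightarrow> represents (U \<union> V) (a \<squnion>\<^bsub>H\<^esub> b)"
  by (simp add: represents_def H.prime_filters_iff)

text \<open>\<open>\<phi>_mono\<close> and \<open>\<phi>_lift\<close> together say that preimages
  under \<open>\<phi>\<close> commute with the downset of \<open>U - V\<close>, and
  \<open>imp_mem_prime_filter\<close> identifies the result. The assumption
  \<open>U \<subseteq> points Z\<close> is what lets \<open>\<phi>_lift\<close> apply.\<close>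

lemma represents_imp:
  assumes U: "represents U a" and V: "represents V b" and UZ: "U \<subseteq> points Z"
  shows "represents (points Z - downset Z (U - V)) (a \<Rrightarrow>\<^bsub>H\<^esub> b)"
  unfolding represents_def
proof (intro conjI ballI)
  have ab: "a \<in> carrier H" "b \<in> carrier H"
    and Ua: "\<And>P. P \<in> prime_filters H \<Longrightarrow> \<phi> P \<in> U \<longleftrightarrow> a \<in> P"
    and Vb: "\<And>P. P \<in> prime_filters H \<Longrightarrow> \<phi> P \<in> V \<longleftrightarrow> b \<in> P"
    using U V by (auto simp: represents_def)
  show "a \<Rrightarrow>\<^bsub>H\<^esub> b \<in> carrier H"
    using ab by (rule H.imp_closed)
  fix P assume P: "P \<in> prime_filters H"
  have le: "ole Z C D \<longleftrightarrow> is_upset (ole X) C D" for C D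
    by (simp add: tensor_def CC_def)
  have "\<phi> P \<in> downset Z (U - V) \<longleftrightarrow> (\<exists>Q\<in>prime_filters H. P \<subseteq> Q \<and> \<phi> Q \<in> U - V)"
  proof
    assume "\<phi> P \<in> downset Z (U - V)"
    then obtain D where D: "D \<in> U - V" "is_upset (ole X) (\<phi> P) D"
      by (auto simp: downset_def le)
    have "D \<in> points Z"
      using D(1) UZ by blast
    then show "\<exists>Q\<in>prime_filters H. P \<subseteq> Q \<and> \<phi> Q \<in> U - V"
      using \<phi>_lift[OF P _ D(2)] D(1) by blast
  next
    assume "\<exists>Q\<in>prime_filters H. P \<subseteq> Q \<and> \<phi> Q \<in> U - V"
    then show "\<phi> P \<in> downset Z (U - V)"
      using \<phi>_mono[OF P] \<phi>_points[OF P] by (auto simp: downset_def le)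
  qed
  then show "\<phi> P \<in> points Z - downset Z (U - V) \<longleftrightarrow> a \<Rrightarrow>\<^bsub>H\<^esub> b \<in> P"
    using \<phi>_points[OF P] Ua Vb H.imp_mem_prime_filter[OF P ab] by auto
qed

lemma exists_representative:
  assumes "U \<in> clopen_upsets Z"
  shows "\<exists>a. represents U a"
  using assms
proof (induction rule: coproduct_induct)
  case (coprod_map i a)
  then show ?case using represents_coprod_map by blast
next
  case bot
  then show ?case using represents_bot by blast
next
  case top
  then show ?case using represents_top by blast
next
  case (Int U V)
  then show ?case using represents_Int by blast
next
  case (Un U V)
  then show ?case using represents_Un by blast
next
  case (imp U V)
  then show ?case using represents_imp clopen_upsets_subset by blast
qed

text \<open>This is preimage under \<open>\<phi>\<close> followed by the inverse of the Stone map of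
  \<open>H\<close>. The description is legitimate because representatives exist and are unique; the
  restriction supplies the extensionality demanded of the mediating homomorphism.\<close>

definition mediating :: "('i \<Rightarrow> 'a set) set set \<Rightarrow> 'c" where
  "mediating = (\<lambda>U\<in>clopen_upsets Z. THE a. represents U a)"

lemma mediating_eq:
  assumes "U \<in> clopen_upsets Z" "represents U a"
  shows "mediating U = a"
proof -
  have "(THE a. represents U a) = a"
    using assms(2) represents_unique[OF _ assms(2)] by (rule the_equality)
  with assms(1) show ?thesis
    by (simp add: mediating_def)
qed

lemma represents_mediating: "U \<in> clopen_upsets Z \<Longrightarrow> represents U (mediating U)"
  using exists_representative mediating_eq by metis

lemma mediating_hom: "mediating \<in> heyting_hom (upset_algebra Z) H"
  unfolding heyting_hom_def mem_Collect_eq upset_algebra_simps(1)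
proof (intro conjI ballI)
  show "mediating \<in> clopen_upsets Z \<rightarrow> carrier H"
    using represents_mediating by (auto simp: represents_def)
  show "mediating \<bottom>\<^bsub>upset_algebra Z\<^esub> = \<bottom>\<^bsub>H\<^esub>"
    unfolding upset_algebra_simps by (intro mediating_eq empty_clopen_upsets represents_bot)
  show "mediating \<top>\<^bsub>upset_algebra Z\<^esub> = \<top>\<^bsub>H\<^esub>"
    unfolding upset_algebra_simps by (intro mediating_eq points_clopen_upsets represents_top)
  fix U V assume UV: "U \<in> clopen_upsets Z" "V \<in> clopen_upsets Z"
  show "mediating (U \<sqinter>\<^bsub>upset_algebra Z\<^esub> V) = mediating U \<sqinter>\<^bsub>H\<^esub> mediating V"
    unfolding upset_algebra_meet(2)[OF UV]
    using UV by (intro mediating_eq clopen_upsets_Int represents_Int represents_mediating)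
  show "mediating (U \<squnion>\<^bsub>upset_algebra Z\<^esub> V) = mediating U \<squnion>\<^bsub>H\<^esub> mediating V"
    unfolding upset_algebra_join(2)[OF UV]
    using UV by (intro mediating_eq clopen_upsets_Un represents_Un represents_mediating)
  show "mediating (U \<Rrightarrow>\<^bsub>upset_algebra Z\<^esub> V) = mediating U \<Rrightarrow>\<^bsub>H\<^esub> mediating V"
    unfolding imp_upset_algebra
    using UV by (intro mediating_eq imp_clopen_upset_Z represents_imp represents_mediating clopen_upsets_subset)
qed

lemma mediating_coprod_map:
  "i \<in> I \<Longrightarrow> a \<in> carrier (G i) \<Longrightarrow> mediating (coprod_map I G i a) = f i a"
  by (intro mediating_eq coprod_map_clopen_upset represents_coprod_map)

lemma mediating_unique:
  assumes h: "h \<in> heyting_hom (upset_algebra Z) H" "h \<in> extensional (carrier (upset_algebra Z))"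
    and gen: "\<And>i a. i \<in> I \<Longrightarrow> a \<in> carrier (G i) \<Longrightarrow> h (coprod_map I G i a) = f i a"
  shows "h = mediating"
proof (rule extensionalityI)
  show "h \<in> extensional (clopen_upsets Z)"
    using h(2) by (simp only: carrier_upset_algebra)
  show "mediating \<in> extensional (clopen_upsets Z)"
    by (simp add: mediating_def)
  \<comment> \<open>Stated for an arbitrary homomorphism, since the induction needs it both for
    \<open>h\<close> and for \<open>mediating\<close>.\<close>
  have hom: "h {} = \<bottom>\<^bsub>H\<^esub>" "h (points Z) = \<top>\<^bsub>H\<^esub>"
    "h (U \<inter> V) = h U \<sqinter>\<^bsub>H\<^esub> h V" "h (U \<union> V) = h U \<squnion>\<^bsub>H\<^esub> h V"
    "h (points Z - downset Z (U - V)) = h U \<Rrightarrow>\<^bsub>H\<^esub> h V"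
    if h: "h \<in> heyting_hom (upset_algebra Z) H" and U: "U \<in> clopen_upsets Z" and V: "V \<in> clopen_upsets Z"
    for h U V
    using h U V unfolding heyting_hom_def
    by (simp_all add: upset_algebra_bot upset_algebra_top carrier_upset_algebra imp_upset_algebra
      flip: upset_algebra_meet(2)[OF U V] upset_algebra_join(2)[OF U V])
  fix U assume "U \<in> clopen_upsets Z"
  then show "h U = mediating U"
  proof (induction rule: coproduct_induct)
    case (coprod_map i a)
    then show ?case
      by (simp only: gen mediating_coprod_map)
  next
    case bot
    show ?case
      using hom(1)[OF h(1) empty_clopen_upsets empty_clopen_upsets]
        hom(1)[OF mediating_hom empty_clopen_upsets empty_clopen_upsets] by simp
  next
    case top
    show ?case
      using hom(2)[OF h(1) empty_clopen_upsets empty_clopen_upsets]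
        hom(2)[OF mediating_hom empty_clopen_upsets empty_clopen_upsets] by simp
  qed (simp_all only: hom[OF h(1)] hom[OF mediating_hom])
qed

end

theorem theorem4p8:
  fixes I :: "'i set" and G :: "'i \<Rightarrow> 'a heyting"
  assumes "\<And>i. i \<in> I \<Longrightarrow> godel_algebra (G i)"
  shows "godel_coproduct TYPE('c) I G
           (upset_algebra (tensor I (\<lambda>i. dual_space (G i))))
           (coprod_map I G)"
proof -
  interpret godel_family I G
    by (rule godel_family.intro) (rule assms)
  show ?thesis
    unfolding godel_coproduct_def
  proof (intro conjI allI impI ballI)
    show "godel_algebra (upset_algebra Z)"
      by (rule godel_Z)
    show "coprod_map I G i \<in> heyting_hom (G i) (upset_algebra Z)" if "i \<in> I" for i
      by (rule coprod_map_hom[OF that])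
    fix H :: "'c heyting" and f
    assume Hf: "godel_algebra H \<and> (\<forall>i\<in>I. f i \<in> heyting_hom (G i) H)"
    interpret H: godel_algebra H
      using Hf by (rule conjunct1)
    interpret godel_cocone I G H f
      by (intro godel_cocone.intro godel_cocone_axioms.intro godel_family_axioms H.godel_algebra_axioms)
        (use Hf in blast)
    show "\<exists>!h. h \<in> heyting_hom (upset_algebra Z) H \<and> h \<in> extensional (carrier (upset_algebra Z)) \<and>
      (\<forall>i\<in>I. \<forall>a\<in>carrier (G i). h (coprod_map I G i a) = f i a)"
    proof (rule ex1I)
      show "mediating \<in> heyting_hom (upset_algebra Z) H \<and>
          mediating \<in> extensional (carrier (upset_algebra Z)) \<and>
          (\<forall>i\<in>I. \<forall>a\<in>carrier (G i). mediating (coprod_map I G i a) = f i a)"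
        using mediating_hom mediating_coprod_map by (simp add: carrier_upset_algebra mediating_def[abs_def])
      show "h = mediating"
        if "h \<in> heyting_hom (upset_algebra Z) H \<and> h \<in> extensional (carrier (upset_algebra Z)) \<and>
          (\<forall>i\<in>I. \<forall>a\<in>carrier (G i). h (coprod_map I G i a) = f i a)" for h
        using that by (intro mediating_unique) simp_all
    qed
  qed
qed

end
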